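(* Let $n\ge2$ and let $C_n$ be the equational theory of $n$-Catalan algebras. Then $\mathrm{Struct}_G(C_n)\cong F_{n,1}$.
   Context: All compositions are written in diagrammatic order. $x_i^j$ denotes the list $x_i,x_{i+1},\dots,x_j$ (empty if $i>j$). **The theory $C_n$.** For $n\ge2$, $C_n$ consists of one $n$-ary function symbol $\otimes$ and the equations, for $0<i<n$, $$\otimes(x_1^i,\otimes(x_{i+1}^{i+n}),x_{i+n+1}^{2n-1})=\otimes(x_1^{i-1},\otimes(x_i^{i+n-1}),x_{i+n}^{2n-1}).$$ **Structure groups.** Let $\mathcal{E}=\langle\mathcal{F}\mid\mathcal{E}_{\mathcal{F}}\rangle_{\mathcal{V}}$ be an equational theory with a countably infinite variable set $\mathcal{V}$, balanced in that both sides of each equation have the same variables, and composable: any two terms $u,v$ occurring as sides of equations in $\mathcal{E}_{\mathcal{F}}$ are unifiable, i.e. $u^\varphi=v^\psi$ for some substitutions $\varphi,\psi:\mathcal{V}\to\mathbb{F}_{\mathcal{F}}(\mathcal{V})$, where $\mathbb{F}_{\mathcal{F}}(\mathcal{V})$ is the absolutely free term algebra and $u^\varphi$ the result of substituting. ($C_n$ is balanced and composable.) For a balanced pair $(s,t)$, $\rho_{s,t}$ is the partial function on $\mathbb{F}_{\mathcal{F}}(\mathcal{V})$ with graph $\{(s^\varphi,t^\varphi)\}$, $\varphi$ ranging over substitutions. An address is a word in the letters $(F,i)$, $F\in\mathcal{F}$ of arity $m$, $1\le i\le m$; $\mathrm{sub}(t,\alpha)$ is the subterm of $t$ at the end of the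 path $\alpha$ from the root of the term tree. $\rho_{s,t}^\alpha$ is the partial function defined on those $u$ for which $\mathrm{sub}(u,\alpha)$ exists and lies in $\mathrm{dom}(\rho_{s,t})$, which replaces the subterm of $u$ at $\alpha$ by its image under $\rho_{s,t}$ and leaves the rest unchanged. $\mathrm{Struct}(\mathcal{E})$ is the (inverse) monoid of partial maps generated under composition by all $\rho_{s,t}^\alpha$ with $(s,t)$ or $(t,s)$ in $\mathcal{E}_{\mathcal{F}}$ and $\alpha$ an address. $\mathrm{Struct}_G(\mathcal{E})$ is the universal group of $\mathrm{Struct}(\mathcal{E})$, obtained by collapsing all idempotents to $1$. **The groups $G_{n,1}$ and $F_{n,1}$.** $n$-ary trees are defined inductively: a single vertex is an $n$-ary tree, and a root vertex with an ordered list of $n$ $n$-ary subtrees $T_1,\dots,T_n$ is an $n$-ary tree. $\ell(T)$ is the set of leaves of $T$. A simple expansion of $T$ replaces a leaf $v$ by a vertex $v$ with $n$ leaf children $\alpha_1(v),\dots,\alpha_n(v)$; an expansion is the result of finitely many successive simple expansions. An $n$-ary tree diagram is a triple $(T_1,T_2,\sigma)$ with $T_1,T_2$ $n$-ary trees with equally many leaves and $\sigma:\ell(T_1)\to\ell(T_2)$ a bijection. A simple expansion of it expands $T_1$ at a leaf $l$, $T_2$ at $\sigma(l)$, and replaces $\sigma$ by $\sigma'$ with $\sigma'(k)=\sigma(k)$ for $k\in\ell(T_1)\setminus\{l\}$ and $\sigma'(\alpha_i(l))=\alpha_i(\sigma(l))$; expansions are finite iterates. Two tree diagrams are equivalent if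 they have a common expansion; equivalence classes $[(T_1,T_2,\sigma)]$ are $n$-ary tree symbols. $G_{n,1}$ is the set of $n$-ary tree symbols with product $[(T_1,T,\sigma)][(T,T_2,\sigma')]=[(T_1,T_2,\sigma\cdot\sigma')]$ (any two symbols have representatives of this form, since any two trees have a common expansion), inverse $[(T_1,T_2,\sigma)]^{-1}=[(T_2,T_1,\sigma^{-1})]$, unit $[(T,T,\mathrm{id})]$. Leaves are ordered left to right (lexicographically by address); $F_{n,1}$ is the subgroup of $G_{n,1}$ of symbols $[(T_1,T_2,\sigma)]$ with $\sigma$ order-preserving. *)

theory Defs
  imports "HOL-Algebra.Group" "HOL-Library.FuncSet" "HOL-Library.List_Lexorder"
begin

section \<open>Terms and equational theories\<close>

text \<open>The variables are indexed by the natural numbers. The function symbols are all the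
  elements of the type \<open>'f\<close>; the arity condition is imposed by \<open>terms\<close>.\<close>

datatype 'f trm = Var nat | App 'f "'f trm list"

record 'f eq_theory =
  arity :: "'f \<Rightarrow> nat"
  eqs :: "('f trm \<times> 'f trm) set"

inductive_set terms :: "('f \<Rightarrow> nat) \<Rightarrow> 'f trm set" for ar :: "'f \<Rightarrow> nat" where
  Var: "Var x \<in> terms ar"
| App: "length ts = ar f \<Longrightarrow> \<forall>t\<in>set ts. t \<in> terms ar \<Longrightarrow> App f ts \<in> terms ar"

primrec subst :: "(nat \<Rightarrow> 'f trm) \<Rightarrow> 'f trm \<Rightarrow> 'f trm" where
  "subst \<phi> (Var x) = \<phi> x"
| "subst \<phi> (App f ts) = App f (map (subst \<phi>) ts)"

primrec vars :: "'f trm \<Rightarrow> nat set" where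
  "vars (Var x) = {x}"
| "vars (App f ts) = \<Union>(set (map vars ts))"


section \<open>Structure monoids and structure groups\<close>

text \<open>Partial functions are identified with their graphs, so that composition in
  diagrammatic order is relational composition \<open>O\<close>.\<close>

definition rho :: "('f \<Rightarrow> nat) \<Rightarrow> 'f trm \<Rightarrow> 'f trm \<Rightarrow> ('f trm \<times> 'f trm) set" where
  "rho ar s t = {(subst \<phi> s, subst \<phi> t) | \<phi>. \<phi> \<in> UNIV \<rightarrow> terms ar}"

lemma single_valued_rho:
  assumes "vars s = vars t"
  shows "single_valued (rho ar s t)"
proof -
  have inj: "\<forall>x\<in>vars u. \<phi> x = \<psi> x" if "subst \<phi> u = subst \<psi> u"
    for \<phi> \<psi> :: "nat \<Rightarrow> 'a trm" and u using that by (induction u) auto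
  have cong: "subst \<phi> u = subst \<psi> u" if "\<forall>x\<in>vars u. \<phi> x = \<psi> x"
    for \<phi> \<psi> :: "nat \<Rightarrow> 'a trm" and u using that by (induction u) auto
  have eq: "subst \<phi> t = subst \<psi> t" if "subst \<phi> s = subst \<psi> s" for \<phi> \<psi> :: "nat \<Rightarrow> 'a trm"
    using inj[OF that] assms by (simp add: cong)
  show ?thesis
    unfolding single_valued_def rho_def by (auto intro: eq)
qed

text \<open>Argument positions, in addresses of subterms and of vertices of trees alike, are counted
  from \<open>0\<close>.\<close>

type_synonym 'f address = "('f \<times> nat) list"

definition addresses :: "('f \<Rightarrow> nat) \<Rightarrow> 'f address set" where
  "addresses ar = lists {(f, i). i < ar f}"

fun sub :: "'f trm \<Rightarrow> 'f address \<Rightarrow> 'f trm option" where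
  "sub t [] = Some t"
| "sub (App f ts) ((g, i) # \<alpha>) = (if g = f \<and> i < length ts then sub (ts ! i) \<alpha> else None)"
| "sub (Var x) (_ # _) = None"

text \<open>\<open>replace_at u \<alpha> q\<close> is only meaningful if \<open>sub u \<alpha>\<close> exists.\<close>

fun replace_at :: "'f trm \<Rightarrow> 'f address \<Rightarrow> 'f trm \<Rightarrow> 'f trm" where
  "replace_at t [] q = q"
| "replace_at (App f ts) ((g, i) # \<alpha>) q = App f (ts[i := replace_at (ts ! i) \<alpha> q])"
| "replace_at (Var x) (_ # _) q = Var x"

definition rho_at ::
    "('f \<Rightarrow> nat) \<Rightarrow> 'f trm \<Rightarrow> 'f trm \<Rightarrow> 'f address \<Rightarrow> ('f trm \<times> 'f trm) set" where
  "rho_at ar s t \<alpha> =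
     {(u, replace_at u \<alpha> q) | u p q. u \<in> terms ar \<and> sub u \<alpha> = Some p \<and> (p, q) \<in> rho ar s t}"

inductive_set struct_maps :: "'f eq_theory \<Rightarrow> ('f trm \<times> 'f trm) set set"
  for \<E> :: "'f eq_theory" where
  one: "Id_on (terms (arity \<E>)) \<in> struct_maps \<E>"
| gen: "(s, t) \<in> eqs \<E> \<or> (t, s) \<in> eqs \<E> \<Longrightarrow> \<alpha> \<in> addresses (arity \<E>) \<Longrightarrow>
        rho_at (arity \<E>) s t \<alpha> \<in> struct_maps \<E>"
| comp: "r \<in> struct_maps \<E> \<Longrightarrow> r' \<in> struct_maps \<E> \<Longrightarrow> r O r' \<in> struct_maps \<E>"

definition Struct :: "'f eq_theory \<Rightarrow> ('f trm \<times> 'f trm) set monoid" where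
  "Struct \<E> = \<lparr>carrier = struct_maps \<E>, mult = (\<lambda>r r'. r O r'), one = Id_on (terms (arity \<E>))\<rparr>"

text \<open>The least monoid congruence identifying every idempotent with the unit. For an inverse
  monoid this is the least group congruence.\<close>

inductive_set idem_cong :: "('a, 'b) monoid_scheme \<Rightarrow> ('a \<times> 'a) set"
  for M :: "('a, 'b) monoid_scheme" where
  idem: "e \<in> carrier M \<Longrightarrow> e \<otimes>\<^bsub>M\<^esub> e = e \<Longrightarrow> (e, \<one>\<^bsub>M\<^esub>) \<in> idem_cong M"
| refl: "a \<in> carrier M \<Longrightarrow> (a, a) \<in> idem_cong M"
| sym: "(a, b) \<in> idem_cong M \<Longrightarrow> (b, a) \<in> idem_cong M"
| trans: "(a, b) \<in> idem_cong M \<Longrightarrow> (b, c) \<in> idem_cong M \<Longrightarrow> (a, c) \<in> idem_cong M"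
| mult: "(a, b) \<in> idem_cong M \<Longrightarrow> (c, d) \<in> idem_cong M \<Longrightarrow>
         (a \<otimes>\<^bsub>M\<^esub> c, b \<otimes>\<^bsub>M\<^esub> d) \<in> idem_cong M"

definition universal_group :: "('a, 'b) monoid_scheme \<Rightarrow> 'a set monoid" where
  "universal_group M =
     \<lparr>carrier = carrier M // idem_cong M,
      mult = (\<lambda>A B. \<Union>a\<in>A. \<Union>b\<in>B. idem_cong M `` {a \<otimes>\<^bsub>M\<^esub> b}),
      one = idem_cong M `` {\<one>\<^bsub>M\<^esub>}\<rparr>"

definition StructG :: "'f eq_theory \<Rightarrow> ('f trm \<times> 'f trm) set set monoid" where
  "StructG \<E> = universal_group (Struct \<E>)"


section \<open>Catalan algebras\<close>

datatype catalan_op = Otimes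

text \<open>The list \<open>x\<^sub>i, \<dots>, x\<^sub>j\<close>, empty if \<open>i > j\<close>.\<close>

definition var_list :: "nat \<Rightarrow> nat \<Rightarrow> 'f trm list" where
  "var_list i j = map Var [i..<Suc j]"

definition Catalan :: "nat \<Rightarrow> catalan_op eq_theory" where
  "Catalan n =
     \<lparr>arity = (\<lambda>_. n),
      eqs = {(App Otimes (var_list 1 i @ [App Otimes (var_list (i + 1) (i + n))]
                            @ var_list (i + n + 1) (2 * n - 1)),
              App Otimes (var_list 1 (i - 1) @ [App Otimes (var_list i (i + n - 1))]
                            @ var_list (i + n) (2 * n - 1)))
             | i. 0 < i \<and> i < n}\<rparr>"


section \<open>Tree diagrams and the groups $G_{n,1}$ and $F_{n,1}$\<close>

datatype tree = Leaf | Node "tree list"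

inductive_set trees :: "nat \<Rightarrow> tree set" for n :: nat where
  Leaf: "Leaf \<in> trees n"
| Node: "length Ts = n \<Longrightarrow> \<forall>T\<in>set Ts. T \<in> trees n \<Longrightarrow> Node Ts \<in> trees n"

text \<open>A vertex is given by its address, the list of child positions on the path from the root;
  the children of the vertex \<open>v\<close> are the \<open>v @ [i]\<close>. The order on \<open>nat list\<close> is the
  lexicographic one.\<close>

primrec leaves :: "tree \<Rightarrow> nat list set" where
  "leaves Leaf = {[]}"
| "leaves (Node Ts) = {i # v | i v. i < length Ts \<and> v \<in> map leaves Ts ! i}"

text \<open>\<open>expand n T v\<close> is only meaningful if \<open>v\<close> is a leaf of \<open>T\<close>.\<close>

fun expand :: "nat \<Rightarrow> tree \<Rightarrow> nat list \<Rightarrow> tree" where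
  "expand n Leaf v = Node (replicate n Leaf)"
| "expand n (Node Ts) [] = Node Ts"
| "expand n (Node Ts) (i # v) = Node (Ts[i := expand n (Ts ! i) v])"

type_synonym diagram = "tree \<times> tree \<times> (nat list \<Rightarrow> nat list)"

text \<open>Extensionality makes the leaf bijection a function on the leaves of the first tree only.\<close>

definition diagrams :: "nat \<Rightarrow> diagram set" where
  "diagrams n = {(T1, T2, \<sigma>). T1 \<in> trees n \<and> T2 \<in> trees n \<and>
     bij_betw \<sigma> (leaves T1) (leaves T2) \<and> \<sigma> \<in> extensional (leaves T1)}"

inductive_set simple_expansion :: "nat \<Rightarrow> (diagram \<times> diagram) set" for n :: nat where
  "(T1, T2, \<sigma>) \<in> diagrams n \<Longrightarrow> l \<in> leaves T1 \<Longrightarrow>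
   \<sigma>' \<in> extensional (leaves (expand n T1 l)) \<Longrightarrow>
   \<forall>k \<in> leaves T1 - {l}. \<sigma>' k = \<sigma> k \<Longrightarrow>
   \<forall>i < n. \<sigma>' (l @ [i]) = \<sigma> l @ [i] \<Longrightarrow>
   ((T1, T2, \<sigma>), (expand n T1 l, expand n T2 (\<sigma> l), \<sigma>')) \<in> simple_expansion n"

definition diagram_equiv :: "nat \<Rightarrow> (diagram \<times> diagram) set" where
  "diagram_equiv n = {(D, D'). D \<in> diagrams n \<and> D' \<in> diagrams n \<and>
     (\<exists>E. (D, E) \<in> (simple_expansion n)\<^sup>* \<and> (D', E) \<in> (simple_expansion n)\<^sup>*)}"

text \<open>The unit is the class of \<open>(T, T, id)\<close> for any tree \<open>T\<close>, here the single vertex.\<close>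

definition G_group :: "nat \<Rightarrow> diagram set monoid" where
  "G_group n =
     \<lparr>carrier = diagrams n // diagram_equiv n,
      mult = (\<lambda>X Y. \<Union>{diagram_equiv n `` {(T1, T2, compose (leaves T1) \<sigma>' \<sigma>)} | T1 T T2 \<sigma> \<sigma>'.
                        (T1, T, \<sigma>) \<in> X \<and> (T, T2, \<sigma>') \<in> Y}),
      one = diagram_equiv n `` {(Leaf, Leaf, restrict id (leaves Leaf))}\<rparr>"

definition F_group :: "nat \<Rightarrow> diagram set monoid" where
  "F_group n = (G_group n)
     \<lparr>carrier := {X \<in> carrier (G_group n).
                    \<exists>T1 T2 \<sigma>. (T1, T2, \<sigma>) \<in> X \<and> strict_mono_on (leaves T1) \<sigma>}\<rparr>"

end

theory Submission
  imports Defs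
begin

text \<open>A pair \<open>(u, v)\<close> in an element \<open>r\<close> of the structure monoid consists of two terms with the same
  variables in the same order, so the shapes of \<open>u\<close> and \<open>v\<close> together with the order-preserving
  bijection of their leaves form a tree diagram. Its class depends only on \<open>r\<close>, because \<open>r\<close> acts
  on leaf addresses by a partial map that commutes with appending words. This gives a homomorphism
  from the structure monoid to \<open>F\<^bsub>n,1\<^esub>\<close>. It identifies \<open>r\<close> and \<open>r'\<close> exactly if they have a common
  pair; then \<open>r r'\<^sup>-\<^sup>1\<close> has a fixed point, hence is a partial identity, and so \<open>r\<close> and \<open>r'\<close> are
  congruent. It is surjective since every term can be rotated into a left comb, so that any two
  terms with the same list of variables are connected by an element of the monoid.\<close>

section \<open>Leaf addresses and substitution at leaves\<close>

text \<open>The empty map must never arise: as an idempotent zero it would collapse the universal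
  group. A composite \<open>r O r'\<close> is nonempty only if some target term of \<open>r\<close>
  is a source term of \<open>r'\<close>, and substitution can fail to arrange this when variables
  repeat. Here the form of the Catalan equations enters: each side lists the variables x_1, ...,
  x_{2n-1} once, in the same order, so the relations survive replacing leaves one by one, by
  position. Every term then expands to every sufficiently deep complete n-ary tree, and any two
  terms meet.

  Words play the role of points: the leaf addresses of an n-ary tree form a complete prefix code, so
  every word over {0, ..., n-1} can be prolonged until it passes through a leaf of any given tree.
  Comparing actions on prolonged words and cancelling the prolongation gives both the transitivity
  of the diagram equivalence and the rigidity of maps with a fixed point.\<close>

abbreviation tms :: "nat \<Rightarrow> 'f trm set" where
  "tms n \<equiv> terms (\<lambda>_. n)"

text \<open>The left-to-right listing is strictly sorted, so an order-preserving leaf bijection is a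
  pairing of two lists by position. The index \<open>k\<close> is the position of the first argument
  in \<open>ts\<close>, which lets argument lists be cut in two.\<close>

fun leaf_list :: "'f trm \<Rightarrow> nat list list" and leaf_lists :: "nat \<Rightarrow> 'f trm list \<Rightarrow> nat list list" where
  "leaf_list (Var x) = [[]]"
| "leaf_list (App f ts) = leaf_lists 0 ts"
| "leaf_lists k [] = []"
| "leaf_lists k (t # ts) = map ((#) k) (leaf_list t) @ leaf_lists (Suc k) ts"

fun labels :: "'f trm \<Rightarrow> nat list" where
  "labels (Var x) = [x]"
| "labels (App f ts) = concat (map labels ts)"

text \<open>The argument of \<open>f\<close> is the number of a leaf in the left-to-right reading,
  the leftmost one having number \<open>k\<close>; \<open>plugs\<close> advances it by the leaves
  already passed. Labels of the original term are discarded.\<close>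

fun plug :: "(nat \<Rightarrow> 'f trm) \<Rightarrow> nat \<Rightarrow> 'f trm \<Rightarrow> 'f trm"
  and plugs :: "(nat \<Rightarrow> 'f trm) \<Rightarrow> nat \<Rightarrow> 'f trm list \<Rightarrow> 'f trm list" where
  "plug f k (Var x) = f k"
| "plug f k (App g ts) = App g (plugs f k ts)"
| "plugs f k [] = []"
| "plugs f k (t # ts) = plug f k t # plugs f (k + length (labels t)) ts"

fun shape :: "'f trm \<Rightarrow> tree" where
  "shape (Var x) = Leaf"
| "shape (App f ts) = Node (map shape ts)"

lemma leaf_lists_append:
  "leaf_lists k (ts @ us) = leaf_lists k ts @ leaf_lists (k + length ts) us"
  by (induction ts arbitrary: k) auto

lemma in_set_leaf_lists:
  "x \<in> set (leaf_lists k ts) \<longleftrightarrow>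
    (\<exists>j w. x = (k + j) # w \<and> j < length ts \<and> w \<in> set (leaf_list (ts ! j)))"
proof (induction ts arbitrary: k)
  case (Cons t ts)
  have "(\<exists>j w. x = (k + j) # w \<and> j < length (t # ts) \<and> w \<in> set (leaf_list ((t # ts) ! j))) \<longleftrightarrow>
     (\<exists>w. x = k # w \<and> w \<in> set (leaf_list t)) \<or>
     (\<exists>j w. x = (Suc k + j) # w \<and> j < length ts \<and> w \<in> set (leaf_list (ts ! j)))"
    (is "?L \<longleftrightarrow> ?R1 \<or> ?R2")
  proof
    assume ?L
    then obtain j w where "x = (k + j) # w" "j < length (t # ts)" "w \<in> set (leaf_list ((t # ts) ! j))"
      by blast
    then show "?R1 \<or> ?R2" by (cases j) auto
  next
    assume "?R1 \<or> ?R2"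
    then show ?L
    proof
      assume ?R1 then show ?L by (intro exI[of _ 0]) auto
    next
      assume ?R2
      then obtain j w where "x = (Suc k + j) # w" "j < length ts" "w \<in> set (leaf_list (ts ! j))"
        by blast
      then show ?L by (intro exI[of _ "Suc j"]) auto
    qed
  qed
  then show ?case using Cons by auto
qed simp

lemma leaf_lists_Suc:
  "leaf_lists (Suc k) ts = map (\<lambda>x. Suc (hd x) # tl x) (leaf_lists k ts)"
  by (induction ts arbitrary: k) auto

lemma set_leaf_list: "set (leaf_list t) = leaves (shape t)"
proof (induction t)
  case (App f ts)
  have "x \<in> set (leaf_list (App f ts)) \<longleftrightarrow> x \<in> leaves (shape (App f ts))" for x
    using App by (auto simp: in_set_leaf_lists)
  then show ?case by blast
qed simp

lemma length_leaf_list [simp]: "length (leaf_list t) = length (labels t)"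
proof (induction t)
  case (App f ts)
  have "length (leaf_lists k ts) = length (concat (map labels ts))" for k
    using App by (induction ts arbitrary: k) auto
  then show ?case by simp
qed simp

lemma sorted_leaf_list: "sorted_wrt (<) (leaf_list t)"
proof (induction t)
  case (App f ts)
  have "sorted_wrt (<) (leaf_lists k ts)" for k
    using App
    by (induction ts arbitrary: k)
      (force simp: sorted_wrt_append sorted_wrt_map in_set_leaf_lists)+
  then show ?case by simp
qed simp

lemma distinct_leaf_list: "distinct (leaf_list t)"
  using sorted_leaf_list strict_sorted_iff by blast

lemma plugs_append:
  "plugs f k (ts @ us) = plugs f k ts @ plugs f (k + length (concat (map labels ts))) us"
  by (induction ts arbitrary: k) (auto simp: add.assoc)

lemma length_plugs [simp]: "length (plugs f k ts) = length ts"
  by (induction ts arbitrary: k) auto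

lemma terms_Var [simp]: "Var x \<in> terms ar"
  by (rule terms.Var)

lemma terms_App [simp]: "App f ts \<in> terms ar \<longleftrightarrow> length ts = ar f \<and> set ts \<subseteq> terms ar"
  using terms.cases[of "App f ts" ar] by (auto intro!: terms.App)

lemma plug_in_terms:
  assumes "f \<in> UNIV \<rightarrow> terms ar"
  shows "t \<in> terms ar \<Longrightarrow> plug f k t \<in> terms ar"
proof (induction t arbitrary: k)
  case (App g ts)
  have "set us \<subseteq> set ts \<Longrightarrow> set (plugs f k us) \<subseteq> terms ar" for k us
  proof (induction us arbitrary: k)
    case (Cons u us)
    then have "u \<in> set ts" "set us \<subseteq> set ts" by auto
    moreover have "u \<in> terms ar" using App.prems \<open>u \<in> set ts\<close> by auto
    ultimately show ?case using Cons.IH App.IH by simp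
  qed simp
  then show ?case using App.prems by auto
qed (use assms in auto)

lemma plugs_in_terms:
  assumes "f \<in> UNIV \<rightarrow> terms ar" "set ts \<subseteq> terms ar"
  shows "set (plugs f k ts) \<subseteq> terms ar"
  using assms(2) by (induction ts arbitrary: k) (auto intro: plug_in_terms[OF assms(1)])

lemma plug_cong:
  "(\<And>j. k \<le> j \<Longrightarrow> j < k + length (labels t) \<Longrightarrow> f j = g j) \<Longrightarrow> plug f k t = plug g k t"
proof (induction t arbitrary: k)
  case (App h ts)
  have "set us \<subseteq> set ts \<Longrightarrow>
      (\<And>j. k \<le> j \<Longrightarrow> j < k + length (concat (map labels us)) \<Longrightarrow> f j = g j) \<Longrightarrow>
      plugs f k us = plugs g k us" for us k
  proof (induction us arbitrary: k)
    case (Cons u us)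
    have "plug f k u = plug g k u"
      by (rule App.IH) (use Cons.prems in auto)
    moreover have "plugs f (k + length (labels u)) us = plugs g (k + length (labels u)) us"
      by (rule Cons.IH) (use Cons.prems in auto)
    ultimately show ?case by simp
  qed simp
  then show ?case using App.prems by simp
qed simp

lemma plugs_cong:
  assumes "\<And>j. k \<le> j \<Longrightarrow> j < k + length (concat (map labels ts)) \<Longrightarrow> f j = g j"
  shows "plugs f k ts = plugs g k ts"
  using plug_cong[of k "App undefined ts" f g] assms by simp

section \<open>Expanding terms to complete trees\<close>

primrec full :: "nat \<Rightarrow> nat \<Rightarrow> catalan_op trm" where
  "full n 0 = Var 0"
| "full n (Suc d) = App Otimes (replicate n (full n d))"

lemma full_in_terms: "full n d \<in> tms n"
  by (induction d) auto

text \<open>The depth bound of a composite is one more than the maximum over its arguments. All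
  \<open>d \<ge> d0\<close> are claimed so that several terms can meet at one depth, and all
  \<open>k\<close> because an argument starts at a leaf number that depends on its left
  neighbours.\<close>

lemma plug_to_full:
  fixes t :: "catalan_op trm"
  assumes "t \<in> tms n"
  shows "\<exists>d0. \<forall>d\<ge>d0. \<forall>k. \<exists>f. f \<in> UNIV \<rightarrow> tms n \<and> plug f k t = full n d"
  using assms
proof (induction t)
  case (Var x)
  show ?case
    by (intro exI[of _ 0] allI impI, rule_tac x = "\<lambda>_. full n d" in exI)
      (use full_in_terms in auto)
next
  case (App ts g)
  have "\<forall>t\<in>set ts. \<exists>d0. \<forall>d\<ge>d0. \<forall>k. \<exists>f. f \<in> UNIV \<rightarrow> tms n \<and> plug f k t = full n d"
    using App by auto
  then obtain D where D: "\<And>t d k. t \<in> set ts \<Longrightarrow> d \<ge> D t \<Longrightarrow>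
      \<exists>f. f \<in> UNIV \<rightarrow> tms n \<and> plug f k t = full n d"
    by metis
  define d0 where "d0 = Max (insert 0 (D ` set ts))"
  have d0: "D t \<le> d0" if "t \<in> set ts" for t
    unfolding d0_def using that by (intro Max_ge) auto
  have *: "\<exists>f. f \<in> UNIV \<rightarrow> tms n \<and> plugs f k us = replicate (length us) (full n d)"
    if "d \<ge> d0" "set us \<subseteq> set ts" for d k us
    using that(2)
  proof (induction us arbitrary: k)
    case Nil
    show ?case by (intro exI[of _ "\<lambda>_. Var 0"]) auto
  next
    case (Cons u us)
    obtain f1 where f1: "f1 \<in> UNIV \<rightarrow> tms n" "plug f1 k u = full n d"
    proof -
      have "u \<in> set ts" using Cons.prems by simp
      then show thesis using D[of u d k] d0[of u] that order.trans[OF d0 \<open>d \<ge> d0\<close>] by blast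
    qed
    obtain f2 where f2: "f2 \<in> UNIV \<rightarrow> tms n"
      "plugs f2 (k + length (labels u)) us = replicate (length us) (full n d)"
      using Cons.IH[of "k + length (labels u)"] Cons.prems by auto
    \<comment> \<open>The leaf numbers of \<open>u\<close> and of \<open>us\<close> occupy disjoint
      intervals, so the two functions can be glued at the cut.\<close>
    let ?f = "\<lambda>j. if j < k + length (labels u) then f1 j else f2 j"
    have "plug ?f k u = full n d" "plugs ?f (k + length (labels u)) us = replicate (length us) (full n d)"
      using f1(2) f2(2) by (auto cong: plug_cong plugs_cong
          simp: plug_cong[of k u ?f f1] plugs_cong[of "k + length (labels u)" us ?f f2])
    moreover have "?f \<in> UNIV \<rightarrow> tms n" using f1(1) f2(1) by (auto simp: Pi_iff)
    ultimately show ?case by (intro exI[of _ ?f]) simp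
  qed
  show ?case
  proof (intro exI[of _ "Suc d0"] allI impI)
    fix d k assume "Suc d0 \<le> d"
    then obtain e where e: "d = Suc e" "e \<ge> d0" by (cases d) auto
    obtain f where "f \<in> UNIV \<rightarrow> tms n" "plugs f k ts = replicate (length ts) (full n e)"
      using *[OF e(2) subset_refl] by blast
    then show "\<exists>f. f \<in> UNIV \<rightarrow> tms n \<and> plug f k (App g ts) = full n d"
      using App.hyps(1) e by (cases g) auto
  qed
qed

text \<open>Plays the part of composability: it makes composites of coherent relations nonempty and
  gives two such relations a common source term.\<close>

lemma plug_unify:
  fixes t u :: "catalan_op trm"
  assumes "t \<in> tms n" "u \<in> tms n"
  obtains f g where "f \<in> UNIV \<rightarrow> tms n" "g \<in> UNIV \<rightarrow> tms n" "plug f 0 t = plug g 0 u"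
proof -
  obtain d1 d2 where
    "\<forall>d\<ge>d1. \<forall>k. \<exists>f. f \<in> UNIV \<rightarrow> tms n \<and> plug f k t = full n d"
    "\<forall>d\<ge>d2. \<forall>k. \<exists>f. f \<in> UNIV \<rightarrow> tms n \<and> plug f k u = full n d"
    using plug_to_full assms by meson
  then show thesis
    using that by (metis max.cobounded1 max.cobounded2)
qed

section \<open>Coherent relations\<close>

text \<open>The map \<open>\<mu>\<close> is the action on words; its values matter only on words that extend the address
  of a leaf. Closure under \<open>plug\<close> is stronger than closure under substitution: it replaces different
  occurrences of one variable by different terms.\<close>

definition coherent :: "nat \<Rightarrow> (catalan_op trm \<times> catalan_op trm) set \<Rightarrow> bool" where
  "coherent n r \<longleftrightarrow> r \<noteq> {} \<and> r \<subseteq> tms n \<times> tms n \<and>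
     (\<forall>(u, v)\<in>r. labels u = labels v \<and>
        (\<forall>f k. f \<in> UNIV \<rightarrow> tms n \<longrightarrow> (plug f k u, plug f k v) \<in> r)) \<and>
     (\<exists>\<mu>. \<forall>(u, v)\<in>r. leaf_list v = map \<mu> (leaf_list u) \<and>
        (\<forall>l\<in>set (leaf_list u). \<forall>w. \<mu> (l @ w) = \<mu> l @ w))"

lemma coherentI:
  assumes "r \<noteq> {}" "\<And>u v. (u, v) \<in> r \<Longrightarrow> u \<in> tms n \<and> v \<in> tms n"
    "\<And>u v. (u, v) \<in> r \<Longrightarrow> labels u = labels v"
    "\<And>u v f k. (u, v) \<in> r \<Longrightarrow> f \<in> UNIV \<rightarrow> tms n \<Longrightarrow> (plug f k u, plug f k v) \<in> r"
    "\<And>u v. (u, v) \<in> r \<Longrightarrow> leaf_list v = map \<mu> (leaf_list u)"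
    "\<And>u v l w. (u, v) \<in> r \<Longrightarrow> l \<in> set (leaf_list u) \<Longrightarrow> \<mu> (l @ w) = \<mu> l @ w"
  shows "coherent n r"
proof -
  have "r \<subseteq> tms n \<times> tms n" using assms(2) by auto
  then show ?thesis
    unfolding coherent_def using assms(1,3-6) by (intro conjI exI[of _ \<mu>]) blast+
qed

lemma coherent_in_terms:
  "coherent n r \<Longrightarrow> (u, v) \<in> r \<Longrightarrow> u \<in> tms n"
  "coherent n r \<Longrightarrow> (u, v) \<in> r \<Longrightarrow> v \<in> tms n"
  unfolding coherent_def by blast+

lemma coherent_labels: "coherent n r \<Longrightarrow> (u, v) \<in> r \<Longrightarrow> labels u = labels v"
  unfolding coherent_def by blast

lemma coherent_plug:
  "coherent n r \<Longrightarrow> (u, v) \<in> r \<Longrightarrow> f \<in> UNIV \<rightarrow> tms n \<Longrightarrow> (plug f k u, plug f k v) \<in> r"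
  unfolding coherent_def by blast

lemma coherent_action:
  assumes "coherent n r"
  obtains \<mu> where "\<And>u v. (u, v) \<in> r \<Longrightarrow> leaf_list v = map \<mu> (leaf_list u)"
    "\<And>u v l w. (u, v) \<in> r \<Longrightarrow> l \<in> set (leaf_list u) \<Longrightarrow> \<mu> (l @ w) = \<mu> l @ w"
  using assms unfolding coherent_def by blast

lemma coherent_Id_on: "coherent n (Id_on (tms n))"
  by (rule coherentI[where \<mu> = id]) (auto intro: plug_in_terms terms_Var)

text \<open>Nonemptiness is the only real issue: a target of \<open>r\<close> and a source of
  \<open>r'\<close> are plugged to one term, and plugging stays inside both relations. The action is
  the composite of the two actions.\<close>

lemma coherent_comp:
  assumes "coherent n r" "coherent n r'"
  shows "coherent n (r O r')"
proof -
  obtain \<mu> where \<mu>: "\<And>u v. (u, v) \<in> r \<Longrightarrow> leaf_list v = map \<mu> (leaf_list u)"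
    "\<And>u v l w. (u, v) \<in> r \<Longrightarrow> l \<in> set (leaf_list u) \<Longrightarrow> \<mu> (l @ w) = \<mu> l @ w"
    using coherent_action[OF assms(1)] by blast
  obtain \<nu> where \<nu>: "\<And>u v. (u, v) \<in> r' \<Longrightarrow> leaf_list v = map \<nu> (leaf_list u)"
    "\<And>u v l w. (u, v) \<in> r' \<Longrightarrow> l \<in> set (leaf_list u) \<Longrightarrow> \<nu> (l @ w) = \<nu> l @ w"
    using coherent_action[OF assms(2)] by blast
  show ?thesis
  proof (rule coherentI[where \<mu> = "\<nu> \<circ> \<mu>"])
    obtain u v v' w where uv: "(u, v) \<in> r" "(v', w) \<in> r'"
      using assms unfolding coherent_def by fast
    obtain f g where "f \<in> UNIV \<rightarrow> tms n" "g \<in> UNIV \<rightarrow> tms n" "plug f 0 v = plug g 0 v'"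
      using plug_unify coherent_in_terms assms uv by metis
    then have "(plug f 0 u, plug f 0 v) \<in> r" "(plug f 0 v, plug g 0 w) \<in> r'"
      using coherent_plug assms uv by metis+
    then show "r O r' \<noteq> {}" by blast
  next
    fix u w l x assume "(u, w) \<in> r O r'" and l: "l \<in> set (leaf_list u)"
    then obtain v where v: "(u, v) \<in> r" "(v, w) \<in> r'" by blast
    \<comment> \<open>The image of a leaf is a leaf of the middle term, where \<open>\<nu>\<close>
      is known to commute with appending.\<close>
    then have "\<mu> l \<in> set (leaf_list v)" using \<mu>(1) l by auto
    then show "(\<nu> \<circ> \<mu>) (l @ x) = (\<nu> \<circ> \<mu>) l @ x"
      using v \<mu>(2) \<nu>(2) l by auto
  next
    fix u w assume "(u, w) \<in> r O r'"
    then obtain v where v: "(u, v) \<in> r" "(v, w) \<in> r'" by blast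
    show "u \<in> tms n \<and> w \<in> tms n" "labels u = labels w" "leaf_list w = map (\<nu> \<circ> \<mu>) (leaf_list u)"
      using coherent_in_terms(1)[OF assms(1) v(1)] coherent_in_terms(2)[OF assms(2) v(2)]
        coherent_labels[OF assms(1) v(1)] coherent_labels[OF assms(2) v(2)] \<mu>(1)[OF v(1)] \<nu>(1)[OF v(2)]
      by auto
    fix f :: "nat \<Rightarrow> catalan_op trm" and k assume "f \<in> UNIV \<rightarrow> tms n"
    then show "(plug f k u, plug f k w) \<in> r O r'"
      using coherent_plug[OF assms(1) v(1)] coherent_plug[OF assms(2) v(2)] by blast
  qed
qed

text \<open>The partial map given by the equation of the theory with index \<open>Suc p\<close>.\<close>

definition rotation :: "nat \<Rightarrow> nat \<Rightarrow> (catalan_op trm \<times> catalan_op trm) set" where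
  "rotation n p =
    {(App Otimes (as @ a # App Otimes (bs @ [b]) # cs), App Otimes (as @ App Otimes (a # bs) # b # cs))
     | as a bs b cs. set (as @ a # bs @ b # cs) \<subseteq> tms n \<and>
        length as = p \<and> Suc (length bs) = n \<and> Suc (Suc (p + length cs)) = n}"

text \<open>Rebracketing moves the argument \<open>a\<close> from p to p,0, the k-th entry of the
  inner bracket from p+1,k to p,k+1, and its last entry \<open>b\<close> from p+1,n-1 to p+1. The
  value \<open>[]\<close> on the words \<open>[]\<close> and \<open>[Suc p]\<close> is a default:
  both are addresses of composite subterms of the source, hence never of leaves.\<close>

definition rotate_address :: "nat \<Rightarrow> nat \<Rightarrow> nat list \<Rightarrow> nat list" where
  "rotate_address n p x = (case x of [] \<Rightarrow> [] | j # w \<Rightarrow>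
     if j = p then p # 0 # w
     else if j = Suc p then
       (case w of [] \<Rightarrow> [] | k # w' \<Rightarrow> if Suc k = n then Suc p # w' else p # Suc k # w')
     else x)"

definition unrotate_address :: "nat \<Rightarrow> nat \<Rightarrow> nat list \<Rightarrow> nat list" where
  "unrotate_address n p x = (case x of [] \<Rightarrow> [] | j # w \<Rightarrow>
     if j = Suc p then Suc p # (n - 1) # w
     else if j = p then
       (case w of [] \<Rightarrow> [] | k # w' \<Rightarrow> (case k of 0 \<Rightarrow> p # w' | Suc m \<Rightarrow> Suc p # m # w'))
     else x)"

lemma map_leaf_lists_id:
  assumes "\<And>j w. k \<le> j \<Longrightarrow> j < k + length ts \<Longrightarrow> g (j # w) = j # w"
  shows "map g (leaf_lists k ts) = leaf_lists k ts"
  by (rule map_idI) (use assms in \<open>auto simp: in_set_leaf_lists\<close>)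

lemma Nil_notin_leaf_lists [simp]: "[] \<notin> set (leaf_lists k ts)"
  by (auto simp: in_set_leaf_lists)

lemma rotationI:
  assumes "set (as @ a # bs @ b # cs) \<subseteq> tms n" "length as = p" "Suc (length bs) = n"
    "Suc (Suc (p + length cs)) = n"
  shows "(App Otimes (as @ a # App Otimes (bs @ [b]) # cs),
      App Otimes (as @ App Otimes (a # bs) # b # cs)) \<in> rotation n p"
  unfolding rotation_def using assms by blast

lemma rotationE:
  assumes "(u, v) \<in> rotation n p"
  obtains as a bs b cs where
    "u = App Otimes (as @ a # App Otimes (bs @ [b]) # cs)"
    "v = App Otimes (as @ App Otimes (a # bs) # b # cs)"
    "set as \<subseteq> tms n" "a \<in> tms n" "set bs \<subseteq> tms n" "b \<in> tms n" "set cs \<subseteq> tms n"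
    "length as = p" "Suc (length bs) = n" "Suc (Suc (p + length cs)) = n"
proof -
  from assms obtain as a bs b cs where "set (as @ a # bs @ b # cs) \<subseteq> tms n"
    and "(u, v) = (App Otimes (as @ a # App Otimes (bs @ [b]) # cs),
      App Otimes (as @ App Otimes (a # bs) # b # cs))"
    "length as = p" "Suc (length bs) = n" "Suc (Suc (p + length cs)) = n"
    unfolding rotation_def by blast
  then show thesis using that[of as a bs b cs] by (simp only: set_append set_simps list.set Un_subset_iff insert_subset prod.inject)
qed

lemma ex_term_list: "\<exists>ts. set ts \<subseteq> terms ar \<and> length ts = k"
  by (rule exI[of _ "replicate k (Var 0)"]) (simp add: subset_iff)

text \<open>The blocks \<open>as\<close>, \<open>a\<close>, \<open>bs\<close>, \<open>b\<close>,
  \<open>cs\<close> stand in the same order on both sides, so labels and leaf numbers agree and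
  plugging yields another instance of the same rotation.\<close>

lemma coherent_rotation:
  assumes "Suc p < n"
  shows "coherent n (rotation n p)"
proof (rule coherentI[where \<mu> = "rotate_address n p"])
  show "rotation n p \<noteq> {}"
  proof -
    obtain m where m: "n = Suc (Suc (p + m))"
      using assms less_iff_Suc_add by auto
    obtain as bs cs :: "catalan_op trm list"
      where "set as \<subseteq> tms n" "set bs \<subseteq> tms n" "set cs \<subseteq> tms n"
        "length as = p" "length bs = Suc (p + m)" "length cs = m"
      using ex_term_list by metis
    then have "(App Otimes (as @ Var 0 # App Otimes (bs @ [Var 0]) # cs),
        App Otimes (as @ App Otimes (Var 0 # bs) # Var 0 # cs)) \<in> rotation n p"
      by (intro rotationI) (simp_all add: m)
    then show ?thesis by blast
  qed
next
  fix u v and f :: "nat \<Rightarrow> catalan_op trm" and k assume "(u, v) \<in> rotation n p" and f: "f \<in> UNIV \<rightarrow> tms n"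
  from this(1) obtain as a bs b cs where
    "u = App Otimes (as @ a # App Otimes (bs @ [b]) # cs)"
    "v = App Otimes (as @ App Otimes (a # bs) # b # cs)"
    "set as \<subseteq> tms n" "a \<in> tms n" "set bs \<subseteq> tms n" "b \<in> tms n" "set cs \<subseteq> tms n"
    "length as = p" "Suc (length bs) = n" "Suc (Suc (p + length cs)) = n"
    by (rule rotationE)
  note * = this
  show "(plug f k u, plug f k v) \<in> rotation n p"
  proof -
    \<comment> \<open>The numbers of the first leaves of \<open>a\<close>, \<open>bs\<close>,
      \<open>b\<close> and \<open>cs\<close>; they are the same in \<open>u\<close> and in
      \<open>v\<close>.\<close>
    define k1 where "k1 = k + length (concat (map labels as))"
    define k2 where "k2 = k1 + length (labels a)"
    define k3 where "k3 = k2 + length (concat (map labels bs))"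
    define k4 where "k4 = k3 + length (labels b)"
    let ?as = "plugs f k as" and ?a = "plug f k1 a" and ?bs = "plugs f k2 bs"
      and ?b = "plug f k3 b" and ?cs = "plugs f k4 cs"
    have "plug f k u = App Otimes (?as @ ?a # App Otimes (?bs @ [?b]) # ?cs)"
      "plug f k v = App Otimes (?as @ App Otimes (?a # ?bs) # ?b # ?cs)"
      unfolding *(1,2) k4_def k3_def k2_def k1_def by (simp_all add: plugs_append add.assoc)
    moreover have "set (?as @ ?a # ?bs @ ?b # ?cs) \<subseteq> tms n"
      using plugs_in_terms[OF f *(3)] plug_in_terms[OF f *(4)] plugs_in_terms[OF f *(5)]
        plug_in_terms[OF f *(6)] plugs_in_terms[OF f *(7)] by simp
    ultimately show ?thesis
      using rotationI[of ?as ?a ?bs ?b ?cs n p] *(8-10) by simp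
  qed
next
  fix u v assume "(u, v) \<in> rotation n p"
  then obtain as a bs b cs where *:
    "u = App Otimes (as @ a # App Otimes (bs @ [b]) # cs)"
    "v = App Otimes (as @ App Otimes (a # bs) # b # cs)"
    "length as = p" "Suc (length bs) = n" "Suc (Suc (p + length cs)) = n"
    using rotationE by (metis converse_iff)
  have "map (rotate_address n p) (leaf_lists 0 as) = leaf_lists 0 as"
    "map (rotate_address n p) (leaf_lists (Suc (Suc p)) cs) = leaf_lists (Suc (Suc p)) cs"
    using * by (auto intro!: map_leaf_lists_id simp: rotate_address_def)
  moreover have "map (rotate_address n p \<circ> (#) (Suc p)) (leaf_lists 0 bs) =
      map ((#) p) (leaf_lists (Suc 0) bs)"
    using * by (auto simp: leaf_lists_Suc rotate_address_def in_set_leaf_lists)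
  moreover have "map (rotate_address n p \<circ> (#) p) (leaf_list a) = map ((#) p \<circ> (#) 0) (leaf_list a)"
    "map (rotate_address n p \<circ> (#) (Suc p) \<circ> (#) (n - 1)) (leaf_list b) = map ((#) (Suc p)) (leaf_list b)"
    using * by (auto simp: rotate_address_def)
  moreover have "length bs = n - 1" using * by simp
  ultimately show "leaf_list v = map (rotate_address n p) (leaf_list u)"
    using * by (simp add: leaf_lists_append o_assoc)
  fix l w assume "l \<in> set (leaf_list u)"
  then obtain j x where l: "l = j # x"
    "x \<in> set (leaf_list ((as @ a # App Otimes (bs @ [b]) # cs) ! j))"
    using *(1) by (auto simp del: leaf_lists.simps simp: in_set_leaf_lists)
  \<comment> \<open>The argument at \<open>Suc p\<close> is a bracket, so a leaf below it has a
    longer address and the default clause of \<open>rotate_address\<close> is avoided.\<close>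
  then have "x \<noteq> []" if "j = Suc p"
    using that *(3) by (auto simp: nth_append)
  then show "rotate_address n p (l @ w) = rotate_address n p l @ w"
    using l(1) by (auto simp: rotate_address_def neq_Nil_conv)
next
  fix u v assume "(u, v) \<in> rotation n p"
  then obtain as a bs b cs where
    "u = App Otimes (as @ a # App Otimes (bs @ [b]) # cs)"
    "v = App Otimes (as @ App Otimes (a # bs) # b # cs)"
    "set as \<subseteq> tms n" "a \<in> tms n" "set bs \<subseteq> tms n" "b \<in> tms n" "set cs \<subseteq> tms n"
    "length as = p" "Suc (length bs) = n" "Suc (Suc (p + length cs)) = n"
    by (rule rotationE)
  then show "u \<in> tms n \<and> v \<in> tms n" "labels u = labels v"
    by simp_all
qed

text \<open>The action clause of \<open>coherent\<close> speaks about extensions of source leaves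
  only, so the converse needs its own explicit action; everything else is inherited from
  \<open>coherent_rotation\<close>.\<close>

lemma coherent_converse_rotation:
  assumes "Suc p < n"
  shows "coherent n ((rotation n p)\<inverse>)"
proof (rule coherentI[where \<mu> = "unrotate_address n p"])
  show "(rotation n p)\<inverse> \<noteq> {}"
    using coherent_rotation[OF assms] by (auto simp: coherent_def)
next
  fix u v assume "(u, v) \<in> (rotation n p)\<inverse>"
  then obtain as a bs b cs where *:
    "v = App Otimes (as @ a # App Otimes (bs @ [b]) # cs)"
    "u = App Otimes (as @ App Otimes (a # bs) # b # cs)"
    "length as = p" "Suc (length bs) = n" "Suc (Suc (p + length cs)) = n"
    using rotationE by (metis converse_iff)
  have "map (unrotate_address n p) (leaf_lists 0 as) = leaf_lists 0 as"
    "map (unrotate_address n p) (leaf_lists (Suc (Suc p)) cs) = leaf_lists (Suc (Suc p)) cs"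
    using * by (auto intro!: map_leaf_lists_id simp: unrotate_address_def)
  moreover have "map (unrotate_address n p \<circ> (#) p) (leaf_lists (Suc 0) bs) =
      map ((#) (Suc p)) (leaf_lists 0 bs)"
    using * by (auto simp: leaf_lists_Suc unrotate_address_def in_set_leaf_lists)
  moreover have "map (unrotate_address n p \<circ> (#) p \<circ> (#) 0) (leaf_list a) = map ((#) p) (leaf_list a)"
    "map (unrotate_address n p \<circ> (#) (Suc p)) (leaf_list b) = map ((#) (Suc p) \<circ> (#) (n - 1)) (leaf_list b)"
    using * by (auto simp: unrotate_address_def)
  moreover have "length bs = n - 1" using * by simp
  ultimately show "leaf_list v = map (unrotate_address n p) (leaf_list u)"
    using * by (simp add: leaf_lists_append o_assoc)
  fix l w assume "l \<in> set (leaf_list u)"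
  then obtain j x where l: "l = j # x"
    "x \<in> set (leaf_list ((as @ App Otimes (a # bs) # b # cs) ! j))"
    using *(2) by (auto simp del: leaf_lists.simps simp: in_set_leaf_lists)
  then have "x \<noteq> []" if "j = p"
    using that *(3) by (auto simp: nth_append)
  then show "unrotate_address n p (l @ w) = unrotate_address n p l @ w"
    using l(1) by (auto simp: unrotate_address_def neq_Nil_conv split: nat.split)
next
  fix u v assume "(u, v) \<in> (rotation n p)\<inverse>"
  then have v: "(v, u) \<in> rotation n p" by simp
  note r = coherent_rotation[OF assms]
  show "u \<in> tms n \<and> v \<in> tms n" "labels u = labels v"
    using coherent_in_terms[OF r v] coherent_labels[OF r v] by auto
  fix f :: "nat \<Rightarrow> catalan_op trm" and k assume "f \<in> UNIV \<rightarrow> tms n"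
  then show "(plug f k u, plug f k v) \<in> (rotation n p)\<inverse>"
    using coherent_plug[OF r v] by simp
qed

definition lift :: "nat \<Rightarrow> nat \<Rightarrow> (catalan_op trm \<times> catalan_op trm) set \<Rightarrow>
    (catalan_op trm \<times> catalan_op trm) set" where
  "lift n i r = {(App Otimes (as @ p # cs), App Otimes (as @ q # cs)) | as p q cs.
     (p, q) \<in> r \<and> length as = i \<and> Suc (i + length cs) = n \<and> set (as @ cs) \<subseteq> tms n}"

lemma liftI:
  assumes "(p, q) \<in> r" "length as = i" "Suc (i + length cs) = n" "set (as @ cs) \<subseteq> tms n"
  shows "(App Otimes (as @ p # cs), App Otimes (as @ q # cs)) \<in> lift n i r"
  unfolding lift_def using assms by blast

text \<open>The action of the lift applies \<open>\<mu>\<close> below child \<open>i\<close> and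
  fixes words that enter another child.\<close>

lemma coherent_lift:
  assumes "coherent n r" "i < n"
  shows "coherent n (lift n i r)"
proof -
  obtain \<mu> where \<mu>: "\<And>u v. (u, v) \<in> r \<Longrightarrow> leaf_list v = map \<mu> (leaf_list u)"
    "\<And>u v l w. (u, v) \<in> r \<Longrightarrow> l \<in> set (leaf_list u) \<Longrightarrow> \<mu> (l @ w) = \<mu> l @ w"
    using coherent_action[OF assms(1)] by blast
  define \<nu> where "\<nu> x = (case x of [] \<Rightarrow> [] | j # w \<Rightarrow> if j = i then i # \<mu> w else x)" for x
  show ?thesis
  proof (rule coherentI[where \<mu> = \<nu>])
    obtain p q where "(p, q) \<in> r" using assms unfolding coherent_def by fast
    then have "(App Otimes (replicate i (Var 0) @ p # replicate (n - Suc i) (Var 0)),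
      App Otimes (replicate i (Var 0) @ q # replicate (n - Suc i) (Var 0))) \<in> lift n i r"
      by (rule liftI) (use assms(2) in \<open>auto simp: in_set_replicate\<close>)
    then show "lift n i r \<noteq> {}" by blast
  next
    fix u v assume "(u, v) \<in> lift n i r"
    then obtain as p q cs where *: "u = App Otimes (as @ p # cs)" "v = App Otimes (as @ q # cs)"
      "(p, q) \<in> r" "length as = i" "Suc (i + length cs) = n" "set as \<subseteq> tms n" "set cs \<subseteq> tms n"
      unfolding lift_def by auto
    show "u \<in> tms n \<and> v \<in> tms n" "labels u = labels v"
      using * coherent_in_terms[OF assms(1)] coherent_labels[OF assms(1)] by auto
    have "map \<nu> (leaf_lists 0 as) = leaf_lists 0 as"
      "map \<nu> (leaf_lists (Suc i) cs) = leaf_lists (Suc i) cs"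
      using * by (auto intro!: map_leaf_lists_id simp: \<nu>_def)
    then show "leaf_list v = map \<nu> (leaf_list u)"
      using * \<mu>(1)[of p q] by (auto simp: leaf_lists_append \<nu>_def)
    show "\<nu> (l @ w) = \<nu> l @ w" if l_in: "l \<in> set (leaf_list u)" for l w
    proof -
      obtain j x where l: "l = j # x" "x \<in> set (leaf_list ((as @ p # cs) ! j))"
        using l_in *(1) by (auto simp del: leaf_lists.simps simp: in_set_leaf_lists)
      then have "\<mu> (x @ w) = \<mu> x @ w" if "j = i"
        using that *(4) \<mu>(2)[OF *(3)] by (auto simp: nth_append)
      then show ?thesis using l(1) by (auto simp: \<nu>_def)
    qed
    fix f :: "nat \<Rightarrow> catalan_op trm" and k assume f: "f \<in> UNIV \<rightarrow> tms n"
    show "(plug f k u, plug f k v) \<in> lift n i r"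
    proof -
      define k1 where "k1 = k + length (concat (map labels as))"
      define k2 where "k2 = k1 + length (labels p)"
      \<comment> \<open>Since \<open>p\<close> and \<open>q\<close> have equally many leaves,
        \<open>cs\<close> starts at the same leaf number on both sides.\<close>
      have "plug f k u = App Otimes (plugs f k as @ plug f k1 p # plugs f k2 cs)"
        "plug f k v = App Otimes (plugs f k as @ plug f k1 q # plugs f k2 cs)"
        using coherent_labels[OF assms(1) *(3)]
        unfolding *(1,2) k2_def k1_def by (simp_all add: plugs_append add.assoc)
      then show ?thesis
        using liftI[OF coherent_plug[OF assms(1) *(3) f], of "plugs f k as" i "plugs f k2 cs" n k1]
          *(4,5) plugs_in_terms[OF f *(6)] plugs_in_terms[OF f *(7)] by simp
    qed
  qed
qed

section \<open>Tree diagrams\<close>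

lemma leaves_Node [simp]:
  "x \<in> leaves (Node Ts) \<longleftrightarrow> (\<exists>i v. x = i # v \<and> i < length Ts \<and> v \<in> leaves (Ts ! i))"
  by auto

declare leaves.simps(2) [simp del]

lemma trees_Leaf [simp]: "Leaf \<in> trees n"
  by (rule trees.Leaf)

lemma trees_Node [simp]: "Node Ts \<in> trees n \<longleftrightarrow> length Ts = n \<and> set Ts \<subseteq> trees n"
  using trees.cases[of "Node Ts" n] by (auto intro!: trees.Node)

lemma leaves_bounded: "T \<in> trees n \<Longrightarrow> l \<in> leaves T \<Longrightarrow> set l \<subseteq> {..<n}"
proof (induction T arbitrary: l)
  case (Node Ts)
  then obtain i v where l: "l = i # v" "i < length Ts" "v \<in> leaves (Ts ! i)" by auto
  have "Ts ! i \<in> set Ts" "Ts ! i \<in> trees n" using Node.prems l by auto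
  then have "set v \<subseteq> {..<n}" using Node.IH l(3) by blast
  then show ?case using l Node.prems by auto
qed simp

lemma leaves_prefix_free:
  "l \<in> leaves T \<Longrightarrow> l' \<in> leaves T \<Longrightarrow> l @ w = l' @ w' \<Longrightarrow> l = l'"
proof (induction T arbitrary: l l')
  case (Node Ts)
  then obtain i v i' v' where l: "l = i # v" "i < length Ts" "v \<in> leaves (Ts ! i)"
    "l' = i' # v'" "i' < length Ts" "v' \<in> leaves (Ts ! i')" by auto
  then show ?case using Node.IH[of "Ts ! i" v v'] Node.prems by auto
qed simp

lemma leaves_nonempty: "n > 0 \<Longrightarrow> T \<in> trees n \<Longrightarrow> leaves T \<noteq> {}"
proof (induction T)
  case (Node Ts)
  then have "Ts ! 0 \<in> set Ts" "Ts ! 0 \<in> trees n" by auto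
  then obtain v where "v \<in> leaves (Ts ! 0)" using Node.IH Node.prems by blast
  then have "0 # v \<in> leaves (Node Ts)" using Node.prems by simp
  then show ?case by blast
qed simp

text \<open>Completeness of the code: \<open>x\<close> either already passes through a leaf, or
  stops at an inner vertex, from which \<open>z\<close> descends to a leaf. With
  \<open>leaves_prefix_free\<close> the leaf so reached is unique.\<close>

lemma leaves_cover:
  assumes "n > 0"
  shows "T \<in> trees n \<Longrightarrow> set x \<subseteq> {..<n} \<Longrightarrow>
    \<exists>z w. set z \<subseteq> {..<n} \<and> (\<exists>l\<in>leaves T. x @ z = l @ w)"
proof (induction T arbitrary: x)
  case Leaf
  show ?case by (intro exI[of _ "[]"] exI[of _ x]) simp
next
  case (Node Ts)
  show ?case
  proof (cases x)
    case Nil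
    obtain l where "l \<in> leaves (Node Ts)" using leaves_nonempty[OF assms Node.prems(1)] by blast
    then show ?thesis
      using Nil leaves_bounded[OF Node.prems(1)] by (intro exI[of _ l] exI[of _ "[]"]) auto
  next
    case (Cons i y)
    then have i: "i < length Ts" using Node.prems by auto
    then have "Ts ! i \<in> set Ts" "Ts ! i \<in> trees n" "set y \<subseteq> {..<n}"
      using Node.prems Cons by auto
    then obtain z w l where "set z \<subseteq> {..<n}" "l \<in> leaves (Ts ! i)" "y @ z = l @ w"
      using Node.IH by blast
    then show ?thesis using Cons i
      by (intro exI[of _ z] exI[of _ w] conjI bexI[of _ "i # l"]) auto
  qed
qed

lemma leaves_inject:
  assumes "n > 0"
  shows "T \<in> trees n \<Longrightarrow> T' \<in> trees n \<Longrightarrow> leaves T = leaves T' \<Longrightarrow> T = T'"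
proof (induction T arbitrary: T')
  case Leaf
  then have "[] \<in> leaves T'" by auto
  then show ?case by (cases T') auto
next
  case (Node Ts)
  show ?case
  proof (cases T')
    case Leaf
    then have "[] \<in> leaves (Node Ts)" using Node.prems by simp
    then show ?thesis by simp
  next
    case (Node Ts')
    have "Ts ! i = Ts' ! i" if "i < n" for i
    proof -
      have "v \<in> leaves (Ts ! i) \<longleftrightarrow> v \<in> leaves (Ts' ! i)" for v
        using that Node.prems Node leaves_Node[of "i # v" Ts] leaves_Node[of "i # v" Ts'] by auto
      moreover have "Ts ! i \<in> set Ts" "Ts' ! i \<in> set Ts'"
        using that Node.prems Node by auto
      moreover have "Ts ! i \<in> trees n" "Ts' ! i \<in> trees n"
        using calculation(2,3) Node.prems Node by auto
      ultimately show ?thesis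
        using Node.IH[of "Ts ! i" "Ts' ! i"] by blast
    qed
    then show ?thesis using Node Node.prems by (auto intro: nth_equalityI)
  qed
qed

lemma leaves_expand:
  "l \<in> leaves T \<Longrightarrow> leaves (expand n T l) = (leaves T - {l}) \<union> {l @ [i] | i. i < n}"
proof (induction T arbitrary: l)
  case Leaf
  then show ?case by (auto simp: set_eq_iff)
next
  case (Node Ts)
  then obtain i v where l: "l = i # v" "i < length Ts" "v \<in> leaves (Ts ! i)" by auto
  have IH: "leaves (expand n (Ts ! i) v) = (leaves (Ts ! i) - {v}) \<union> {v @ [i] | i. i < n}"
    using Node.IH l by simp
  have "x \<in> leaves (expand n (Node Ts) l) \<longleftrightarrow>
      x \<in> (leaves (Node Ts) - {l}) \<union> {l @ [i] | i. i < n}" for x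
  proof (cases x)
    case Nil
    then show ?thesis using l by simp
  next
    case (Cons j y)
    then show ?thesis using l IH by (cases "j = i") auto
  qed
  then show ?case by blast
qed

lemma expand_in_trees: "T \<in> trees n \<Longrightarrow> l \<in> leaves T \<Longrightarrow> expand n T l \<in> trees n"
proof (induction T arbitrary: l)
  case (Node Ts)
  then obtain i v where l: "l = i # v" "i < length Ts" "v \<in> leaves (Ts ! i)" by auto
  have "Ts ! i \<in> set Ts" "Ts ! i \<in> trees n" using Node.prems l by auto
  then have "expand n (Ts ! i) v \<in> trees n"
    using Node.IH l(3) by blast
  then show ?case using Node.prems l set_update_subset_insert[of Ts i] by auto
qed auto

lemma child_notin_leaves: "l \<in> leaves T \<Longrightarrow> l @ [i] \<notin> leaves T"
  using leaves_prefix_free[of l T "l @ [i]" "[i]" "[]"] by auto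

lemma simple_expansionE:
  assumes "(D, E) \<in> simple_expansion n"
  obtains T1 T2 \<sigma> l \<sigma>' where "D = (T1, T2, \<sigma>)" "E = (expand n T1 l, expand n T2 (\<sigma> l), \<sigma>')"
    "(T1, T2, \<sigma>) \<in> diagrams n" "l \<in> leaves T1" "\<sigma>' \<in> extensional (leaves (expand n T1 l))"
    "\<forall>k\<in>leaves T1 - {l}. \<sigma>' k = \<sigma> k" "\<forall>i<n. \<sigma>' (l @ [i]) = \<sigma> l @ [i]"
  using assms by (cases D; cases E; hypsubst; elim simple_expansion.cases) blast

lemma simple_expansion_in_diagrams:
  assumes "(D, E) \<in> simple_expansion n"
  shows "E \<in> diagrams n"
proof -
  obtain T1 T2 \<sigma> l \<sigma>' where 1: "D = (T1, T2, \<sigma>)" "E = (expand n T1 l, expand n T2 (\<sigma> l), \<sigma>')"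
    "(T1, T2, \<sigma>) \<in> diagrams n" "l \<in> leaves T1" "\<sigma>' \<in> extensional (leaves (expand n T1 l))"
    "\<forall>k\<in>leaves T1 - {l}. \<sigma>' k = \<sigma> k" "\<forall>i<n. \<sigma>' (l @ [i]) = \<sigma> l @ [i]"
    using assms by (rule simple_expansionE)
  have D: "T1 \<in> trees n" "T2 \<in> trees n" "bij_betw \<sigma> (leaves T1) (leaves T2)"
    using 1 by (auto simp: diagrams_def)
  have l2: "\<sigma> l \<in> leaves T2" using D(3) 1(4) by (auto simp: bij_betw_def)
  have "bij_betw \<sigma> (leaves T1 - {l}) (leaves T2 - {\<sigma> l})"
    using bij_betw_DiffI[OF D(3), of "{l}" "{\<sigma> l}"] 1(4) l2 by auto
  then have "bij_betw \<sigma>' (leaves T1 - {l}) (leaves T2 - {\<sigma> l})"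
    using bij_betw_cong[of "leaves T1 - {l}" \<sigma> \<sigma>'] 1(6) by simp
  moreover have "bij_betw \<sigma>' {l @ [i] | i. i < n} {\<sigma> l @ [i] | i. i < n}"
    unfolding bij_betw_def
  proof
    show "inj_on \<sigma>' {l @ [i] | i. i < n}" using 1(7) by (auto simp: inj_on_def)
    show "\<sigma>' ` {l @ [i] | i. i < n} = {\<sigma> l @ [i] | i. i < n}" using 1(7) by force
  qed
  moreover have "(leaves T2 - {\<sigma> l}) \<inter> {\<sigma> l @ [i] | i. i < n} = {}"
    using child_notin_leaves[OF l2] by auto
  ultimately have "bij_betw \<sigma>' (leaves (expand n T1 l)) (leaves (expand n T2 (\<sigma> l)))"
    unfolding leaves_expand[OF 1(4)] leaves_expand[OF l2] by (rule bij_betw_combine)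
  then show ?thesis
    using 1 D l2 by (simp add: diagrams_def expand_in_trees)
qed

text \<open>The trace that a chain of expansions leaves on the bijections. Concatenating the words
  \<open>w\<close> makes it transitive, so one expansion step settles all chains.\<close>

definition refines :: "nat \<Rightarrow> diagram \<Rightarrow> diagram \<Rightarrow> bool" where
  "refines n = (\<lambda>(T1, T2, \<sigma>) (S1, S2, \<tau>).
     \<forall>s\<in>leaves S1. \<exists>l\<in>leaves T1. \<exists>w. set w \<subseteq> {..<n} \<and> s = l @ w \<and> \<tau> s = \<sigma> l @ w)"

lemma refines_refl: "refines n D D"
  by (cases D) (force simp: refines_def)

lemma refines_trans: "refines n D E \<Longrightarrow> refines n E F \<Longrightarrow> refines n D F"
proof -
  assume DE: "refines n D E" and EF: "refines n E F"
  obtain T1 T2 \<sigma> S1 S2 \<tau> R1 R2 \<rho> where [simp]: "D = (T1, T2, \<sigma>)" "E = (S1, S2, \<tau>)" "F = (R1, R2, \<rho>)"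
    by (metis prod_cases3)
  show ?thesis
    unfolding refines_def \<open>D = _\<close> \<open>F = _\<close> prod.case
  proof
    fix r assume "r \<in> leaves R1"
    then obtain s w where s: "s \<in> leaves S1" "set w \<subseteq> {..<n}" "r = s @ w" "\<rho> r = \<tau> s @ w"
      using EF by (auto simp: refines_def)
    then obtain l w' where l: "l \<in> leaves T1" "set w' \<subseteq> {..<n}" "s = l @ w'" "\<tau> s = \<sigma> l @ w'"
      using DE unfolding refines_def by fastforce
    then show "\<exists>l\<in>leaves T1. \<exists>w. set w \<subseteq> {..<n} \<and> r = l @ w \<and> \<rho> r = \<sigma> l @ w"
      using s by (intro bexI[of _ l] exI[of _ "w' @ w"]) auto
  qed
qed

lemma simple_expansion_refines:
  assumes "(D, E) \<in> simple_expansion n"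
  shows "refines n D E"
proof -
  obtain T1 T2 \<sigma> l \<sigma>' where 1: "D = (T1, T2, \<sigma>)" "E = (expand n T1 l, expand n T2 (\<sigma> l), \<sigma>')"
    "(T1, T2, \<sigma>) \<in> diagrams n" "l \<in> leaves T1" "\<sigma>' \<in> extensional (leaves (expand n T1 l))"
    "\<forall>k\<in>leaves T1 - {l}. \<sigma>' k = \<sigma> k" "\<forall>i<n. \<sigma>' (l @ [i]) = \<sigma> l @ [i]"
    using assms by (rule simple_expansionE)
  show ?thesis
    unfolding 1(1,2) refines_def prod.case
  proof
    fix s assume "s \<in> leaves (expand n T1 l)"
    then consider "s \<in> leaves T1 - {l}" | i where "s = l @ [i]" "i < n"
      using leaves_expand[OF 1(4)] by auto
    then show "\<exists>k\<in>leaves T1. \<exists>w. set w \<subseteq> {..<n} \<and> s = k @ w \<and> \<sigma>' s = \<sigma> k @ w"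
    proof cases
      case a: 1
      then show ?thesis using 1(6) by (intro bexI[of _ s] exI[of _ "[]"]) auto
    next
      case (2 i)
      then show ?thesis using 1(4,7) by (intro bexI[of _ l] exI[of _ "[i]"]) auto
    qed
  qed
qed

lemma expansions_refine:
  assumes "(D, E) \<in> (simple_expansion n)\<^sup>*" "D \<in> diagrams n"
  shows "E \<in> diagrams n \<and> refines n D E"
  using assms
  by (induction rule: rtrancl_induct)
    (blast intro: refines_refl refines_trans simple_expansion_refines simple_expansion_in_diagrams)+

lemma simple_expansion_exists:
  assumes "(T1, T2, \<sigma>) \<in> diagrams n" "l \<in> leaves T1"
  shows "\<exists>T2' \<sigma>'. ((T1, T2, \<sigma>), (expand n T1 l, T2', \<sigma>')) \<in> simple_expansion n"
proof -
  \<comment> \<open>A new leaf is \<open>l @ [i]\<close>, so \<open>last k\<close> recovers its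
    child number; old leaves keep their image.\<close>
  define \<sigma>' where "\<sigma>' = restrict (\<lambda>k. if k \<in> leaves T1 then \<sigma> k else \<sigma> l @ [last k])
    (leaves (expand n T1 l))"
  have "((T1, T2, \<sigma>), (expand n T1 l, expand n T2 (\<sigma> l), \<sigma>')) \<in> simple_expansion n"
  proof (rule simple_expansion.intros[OF assms])
    show "\<sigma>' \<in> extensional (leaves (expand n T1 l))" by (simp add: \<sigma>'_def)
    show "\<forall>k\<in>leaves T1 - {l}. \<sigma>' k = \<sigma> k"
      using leaves_expand[OF assms(2), of n] by (auto simp: \<sigma>'_def)
    show "\<forall>i<n. \<sigma>' (l @ [i]) = \<sigma> l @ [i]"
      using leaves_expand[OF assms(2), of n] child_notin_leaves[OF assms(2)] by (auto simp: \<sigma>'_def)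
  qed
  then show ?thesis by blast
qed

section \<open>Common expansions of trees\<close>

definition tree_expansion :: "nat \<Rightarrow> (tree \<times> tree) set" where
  "tree_expansion n = {(T, expand n T l) | T l. T \<in> trees n \<and> l \<in> leaves T}"

lemma tree_expansions_in_trees:
  "(T, S) \<in> (tree_expansion n)\<^sup>* \<Longrightarrow> T \<in> trees n \<Longrightarrow> S \<in> trees n"
  by (induction rule: rtrancl_induct) (auto simp: tree_expansion_def expand_in_trees)

text \<open>The bijection dictates which leaf of the second tree is expanded along, so common
  expansions of diagrams can be sought among the first trees alone.\<close>

lemma tree_expansions_lift:
  assumes "(T1, S) \<in> (tree_expansion n)\<^sup>*" "(T1, T2, \<sigma>) \<in> diagrams n"
  shows "\<exists>S2 \<tau>. ((T1, T2, \<sigma>), (S, S2, \<tau>)) \<in> (simple_expansion n)\<^sup>*"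
  using assms(1)
proof (induction rule: rtrancl_induct)
  case (step S S')
  then obtain S2 \<tau> where *: "((T1, T2, \<sigma>), (S, S2, \<tau>)) \<in> (simple_expansion n)\<^sup>*" by blast
  then have "(S, S2, \<tau>) \<in> diagrams n" using expansions_refine assms(2) by blast
  moreover obtain l where "S' = expand n S l" "l \<in> leaves S"
    using step by (auto simp: tree_expansion_def)
  ultimately show ?case
    using simple_expansion_exists[of S S2 \<tau> n l] * by (meson rtrancl.rtrancl_into_rtrancl)
qed blast

lemma tree_expansion_Node1:
  assumes "(T, S) \<in> (tree_expansion n)\<^sup>*" "set Ts \<subseteq> trees n" "set Us \<subseteq> trees n" "T \<in> trees n"
    "Suc (length Ts + length Us) = n"
  shows "(Node (Ts @ T # Us), Node (Ts @ S # Us)) \<in> (tree_expansion n)\<^sup>*"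
  using assms(1)
proof (induction rule: rtrancl_induct)
  case (step S S')
  then obtain l where l: "S' = expand n S l" "l \<in> leaves S" "S \<in> trees n"
    by (auto simp: tree_expansion_def)
  have "Node (Ts @ S' # Us) = expand n (Node (Ts @ S # Us)) (length Ts # l)"
    using l by simp
  moreover have "length Ts # l \<in> leaves (Node (Ts @ S # Us))" using l by simp
  moreover have "Node (Ts @ S # Us) \<in> trees n" using assms l by simp
  ultimately have "(Node (Ts @ S # Us), Node (Ts @ S' # Us)) \<in> tree_expansion n"
    unfolding tree_expansion_def by blast
  then show ?case using step by (meson rtrancl.rtrancl_into_rtrancl)
qed blast

text \<open>The children are expanded one after another; \<open>Us\<close> collects those already
  treated.\<close>

lemma tree_expansion_Node:
  assumes "list_all2 (\<lambda>T S. (T, S) \<in> (tree_expansion n)\<^sup>*) Ts Ss"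
    "set Us \<subseteq> trees n" "set Ts \<subseteq> trees n" "length Us + length Ts = n"
  shows "(Node (Us @ Ts), Node (Us @ Ss)) \<in> (tree_expansion n)\<^sup>*"
  using assms
proof (induction arbitrary: Us rule: list_all2_induct)
  case (Cons T Ts S Ss)
  have "(Node (Us @ T # Ts), Node (Us @ S # Ts)) \<in> (tree_expansion n)\<^sup>*"
    by (rule tree_expansion_Node1) (use Cons in auto)
  moreover have "S \<in> trees n" using Cons tree_expansions_in_trees[of T S n] by simp
  then have "(Node ((Us @ [S]) @ Ts), Node ((Us @ [S]) @ Ss)) \<in> (tree_expansion n)\<^sup>*"
    by (intro Cons.IH) (use Cons in auto)
  ultimately show ?case by simp
qed simp

primrec full_tree :: "nat \<Rightarrow> nat \<Rightarrow> tree" where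
  "full_tree n 0 = Leaf"
| "full_tree n (Suc d) = Node (replicate n (full_tree n d))"

lemma Leaf_to_full_tree: "(Leaf, full_tree n d) \<in> (tree_expansion n)\<^sup>*"
proof (induction d)
  case (Suc d)
  have "(Leaf, Node (replicate n Leaf)) \<in> tree_expansion n"
    unfolding tree_expansion_def by (intro CollectI exI[of _ Leaf] exI[of _ "[]"]) auto
  moreover have "(Node ([] @ replicate n Leaf), Node ([] @ replicate n (full_tree n d)))
      \<in> (tree_expansion n)\<^sup>*"
    by (rule tree_expansion_Node) (use Suc in \<open>auto simp: list_all2_conv_all_nth in_set_replicate\<close>)
  ultimately show ?case by simp
qed simp

text \<open>A statement about all large depths, so that two trees reach the same complete tree at
  the larger of their bounds.\<close>

lemma tree_to_full_tree:
  "T \<in> trees n \<Longrightarrow> \<exists>d0. \<forall>d\<ge>d0. (T, full_tree n d) \<in> (tree_expansion n)\<^sup>*"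
proof (induction T)
  case Leaf
  then show ?case using Leaf_to_full_tree by blast
next
  case (Node Ts)
  then have "\<forall>T\<in>set Ts. \<exists>d0. \<forall>d\<ge>d0. (T, full_tree n d) \<in> (tree_expansion n)\<^sup>*"
    by auto
  then obtain D where D: "\<And>T d. T \<in> set Ts \<Longrightarrow> d \<ge> D T \<Longrightarrow> (T, full_tree n d) \<in> (tree_expansion n)\<^sup>*"
    by metis
  define d0 where "d0 = Max (insert 0 (D ` set Ts))"
  have d0: "D T \<le> d0" if "T \<in> set Ts" for T
    unfolding d0_def using that by (intro Max_ge) auto
  show ?case
  proof (intro exI[of _ "Suc d0"] allI impI)
    fix d assume "Suc d0 \<le> d"
    then obtain e where e: "d = Suc e" "e \<ge> d0" by (cases d) auto
    have "(Node ([] @ Ts), Node ([] @ replicate n (full_tree n e))) \<in> (tree_expansion n)\<^sup>*"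
    proof (rule tree_expansion_Node)
      show "list_all2 (\<lambda>T S. (T, S) \<in> (tree_expansion n)\<^sup>*) Ts (replicate n (full_tree n e))"
        unfolding list_all2_conv_all_nth
      proof (intro conjI allI impI)
        fix i assume i: "i < length Ts"
        then have "D (Ts ! i) \<le> e" using d0 e(2) by (meson nth_mem order.trans)
        then show "(Ts ! i, replicate n (full_tree n e) ! i) \<in> (tree_expansion n)\<^sup>*"
          using D i Node.prems by simp
      qed (use Node.prems in simp)
    qed (use Node.prems in auto)
    then show "(Node Ts, full_tree n d) \<in> (tree_expansion n)\<^sup>*" using e by simp
  qed
qed

text \<open>Equivalence of diagrams is equality of their actions on words, wherever both are defined. In
  this form transitivity and compatibility with products need no common expansions.\<close>

definition agree :: "nat \<Rightarrow> diagram \<Rightarrow> diagram \<Rightarrow> bool" where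
  "agree n = (\<lambda>(T1, T2, \<sigma>) (S1, S2, \<tau>).
     \<forall>l\<in>leaves T1. \<forall>s\<in>leaves S1. \<forall>w x. set w \<subseteq> {..<n} \<longrightarrow> l @ w = s @ x \<longrightarrow> \<sigma> l @ w = \<tau> s @ x)"

lemma agreeI:
  assumes "\<And>l s w x. l \<in> leaves T1 \<Longrightarrow> s \<in> leaves S1 \<Longrightarrow> set w \<subseteq> {..<n} \<Longrightarrow> l @ w = s @ x \<Longrightarrow>
    \<sigma> l @ w = \<tau> s @ x"
  shows "agree n (T1, T2, \<sigma>) (S1, S2, \<tau>)"
  using assms unfolding agree_def by blast

lemma agreeD:
  assumes "agree n (T1, T2, \<sigma>) (S1, S2, \<tau>)" "l \<in> leaves T1" "s \<in> leaves S1" "set w \<subseteq> {..<n}"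
    "l @ w = s @ x"
  shows "\<sigma> l @ w = \<tau> s @ x"
  using assms unfolding agree_def by blast

text \<open>By prefix-freeness the coarse leaf above \<open>s\<close> provided by
  \<open>refines\<close> must be \<open>l\<close> itself.\<close>

lemma refines_agree:
  assumes "refines n (T1, T2, \<sigma>) (S1, S2, \<tau>)"
  shows "agree n (T1, T2, \<sigma>) (S1, S2, \<tau>)"
proof (rule agreeI)
  fix l s w x assume *: "l \<in> leaves T1" "s \<in> leaves S1" "l @ w = s @ x"
  then obtain k y where "k \<in> leaves T1" "s = k @ y" "\<tau> s = \<sigma> k @ y"
    using assms by (auto simp: refines_def)
  then show "\<sigma> l @ w = \<tau> s @ x"
    using leaves_prefix_free[of l T1 k w "y @ x"] * by auto
qed

text \<open>\<open>agree\<close> bounds the letters of the tail on one side only; the bound passes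
  to the other side because leaf addresses of \<open>n\<close>-ary trees use only letters below
  \<open>n\<close>.\<close>

lemma agree_sym:
  assumes "agree n (T1, T2, \<sigma>) (S1, S2, \<tau>)" "T1 \<in> trees n" "S1 \<in> trees n"
  shows "agree n (S1, S2, \<tau>) (T1, T2, \<sigma>)"
proof (rule agreeI)
  fix s l x w assume *: "s \<in> leaves S1" "l \<in> leaves T1" "set x \<subseteq> {..<n}" "s @ x = l @ w"
  then have "set (l @ w) \<subseteq> {..<n}"
    using leaves_bounded[OF assms(3) *(1)] by (simp flip: *(4))
  then show "\<tau> s @ x = \<sigma> l @ w" using agreeD[OF assms(1) *(2,1) _ *(4)[symmetric]] by simp
qed

text \<open>A word passing leaves of the outer trees may stop above the leaves of the middle tree.
  It is prolonged by \<open>z\<close> to reach a leaf there, both agreements are applied, and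
  \<open>z\<close> is cancelled.\<close>

lemma agree_trans:
  assumes "agree n (T1, T2, \<sigma>) (S1, S2, \<tau>)" "agree n (S1, S2, \<tau>) (R1, R2, \<rho>)"
    and "n > 0" "T1 \<in> trees n" "S1 \<in> trees n"
  shows "agree n (T1, T2, \<sigma>) (R1, R2, \<rho>)"
proof (rule agreeI)
  fix l r w x assume *: "l \<in> leaves T1" "r \<in> leaves R1" "set w \<subseteq> {..<n}" "l @ w = r @ x"
  have lw: "set (l @ w) \<subseteq> {..<n}" using leaves_bounded[OF assms(4) *(1)] *(3) by simp
  obtain z y s where z: "set z \<subseteq> {..<n}" "s \<in> leaves S1" "(l @ w) @ z = s @ y"
    using leaves_cover[OF assms(3,5) lw] by blast
  have "set (s @ y) \<subseteq> {..<n}" using lw z(1) by (simp flip: z(3))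
  then have y: "set y \<subseteq> {..<n}" by simp
  have "\<sigma> l @ w @ z = \<tau> s @ y"
    by (rule agreeD[OF assms(1) *(1) z(2)]) (use *(3) z(1,3) in auto)
  moreover have "s @ y = r @ x @ z" using z(3) *(4) by (metis append.assoc)
  then have "\<tau> s @ y = \<rho> r @ x @ z"
    by (rule agreeD[OF assms(2) z(2) *(2) y])
  ultimately show "\<sigma> l @ w = \<rho> r @ x" by (metis append.assoc append_same_eq)
qed

text \<open>For the converse direction both first trees are expanded to one complete tree. The
  expanded diagrams still agree, and agreement over the same first tree is equality.\<close>

lemma diagram_equiv_iff:
  assumes "n > 0"
  shows "((T1, T2, \<sigma>), (S1, S2, \<tau>)) \<in> diagram_equiv n \<longleftrightarrow>
    (T1, T2, \<sigma>) \<in> diagrams n \<and> (S1, S2, \<tau>) \<in> diagrams n \<and> agree n (T1, T2, \<sigma>) (S1, S2, \<tau>)"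
    (is "?L \<longleftrightarrow> ?D \<and> ?E \<and> ?A")
proof (intro iffI conjI; (elim conjE)?)
  assume ?L
  then show ?D ?E by (auto simp: diagram_equiv_def)
  then have trees: "T1 \<in> trees n" "S1 \<in> trees n" by (auto simp: diagrams_def)
  obtain R1 R2 \<rho> where "((T1, T2, \<sigma>), (R1, R2, \<rho>)) \<in> (simple_expansion n)\<^sup>*"
    "((S1, S2, \<tau>), (R1, R2, \<rho>)) \<in> (simple_expansion n)\<^sup>*"
    using \<open>?L\<close> by (auto simp: diagram_equiv_def)
  then have R: "(R1, R2, \<rho>) \<in> diagrams n" "refines n (T1, T2, \<sigma>) (R1, R2, \<rho>)"
    "refines n (S1, S2, \<tau>) (R1, R2, \<rho>)"
    using expansions_refine \<open>?D\<close> \<open>?E\<close> by blast+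
  then have "R1 \<in> trees n" by (auto simp: diagrams_def)
  then show ?A
    using agree_trans[OF refines_agree agree_sym[OF refines_agree]] R assms trees by blast
next
  assume D: ?D and E: ?E and A: ?A
  then have trees: "T1 \<in> trees n" "S1 \<in> trees n" by (auto simp: diagrams_def)
  obtain d1 d2 where "\<forall>d\<ge>d1. (T1, full_tree n d) \<in> (tree_expansion n)\<^sup>*"
    "\<forall>d\<ge>d2. (S1, full_tree n d) \<in> (tree_expansion n)\<^sup>*"
    using tree_to_full_tree trees by metis
  then obtain R where R: "(T1, R) \<in> (tree_expansion n)\<^sup>*" "(S1, R) \<in> (tree_expansion n)\<^sup>*"
    by (meson max.cobounded1 max.cobounded2)
  obtain R2 \<rho> where 1: "((T1, T2, \<sigma>), (R, R2, \<rho>)) \<in> (simple_expansion n)\<^sup>*"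
    using tree_expansions_lift[OF R(1) D] by blast
  obtain Q2 \<theta> where 2: "((S1, S2, \<tau>), (R, Q2, \<theta>)) \<in> (simple_expansion n)\<^sup>*"
    using tree_expansions_lift[OF R(2) E] by blast
  have R': "(R, R2, \<rho>) \<in> diagrams n" "(R, Q2, \<theta>) \<in> diagrams n"
    "agree n (T1, T2, \<sigma>) (R, R2, \<rho>)" "agree n (S1, S2, \<tau>) (R, Q2, \<theta>)"
    using expansions_refine[OF 1 D] expansions_refine[OF 2 E] refines_agree by blast+
  then have "R \<in> trees n" by (auto simp: diagrams_def)
  then have agr: "agree n (R, R2, \<rho>) (R, Q2, \<theta>)"
    using agree_trans agree_sym R' A trees assms by meson
  \<comment> \<open>Agreement at empty tails; the second trees then have the same set of leaves,
    which determines them.\<close>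
  have eq: "\<rho> l = \<theta> l" if "l \<in> leaves R" for l
    using agreeD[OF agr that that, of "[]" "[]"] by simp
  have "\<rho> = \<theta>"
    by (rule extensionalityI[OF _ _ eq]) (use R'(1,2) in \<open>auto simp: diagrams_def\<close>)
  moreover have "leaves R2 = leaves Q2"
    using R'(1,2) \<open>\<rho> = \<theta>\<close> by (auto simp: diagrams_def bij_betw_def)
  then have "R2 = Q2"
    by (rule leaves_inject[OF assms, rotated 2]) (use R'(1,2) in \<open>auto simp: diagrams_def\<close>)
  ultimately show ?L
    using D E 1 2 by (auto simp: diagram_equiv_def)
qed

lemma equiv_diagram_equiv:
  assumes "n > 0"
  shows "equiv (diagrams n) (diagram_equiv n)"
proof (rule equivI)
  show "diagram_equiv n \<subseteq> diagrams n \<times> diagrams n" by (auto simp: diagram_equiv_def)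
  show "refl_on (diagrams n) (diagram_equiv n)"
    by (auto simp: refl_on_def diagram_equiv_def)
  show "sym (diagram_equiv n)"
    by (auto simp: sym_def diagram_equiv_def)
  show "trans (diagram_equiv n)"
    unfolding trans_def
  proof (intro allI impI)
    fix D E F assume DE: "(D, E) \<in> diagram_equiv n" and EF: "(E, F) \<in> diagram_equiv n"
    obtain T1 T2 \<sigma> S1 S2 \<tau> R1 R2 \<rho> where
      [simp]: "D = (T1, T2, \<sigma>)" "E = (S1, S2, \<tau>)" "F = (R1, R2, \<rho>)"
      by (metis prod_cases3)
    show "(D, F) \<in> diagram_equiv n"
      using DE EF agree_trans[of n T1 T2 \<sigma> S1 S2 \<tau> R1 R2 \<rho>] assms
      by (simp add: diagram_equiv_iff) (auto simp: diagrams_def)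
  qed
qed

lemma compose_in_diagrams:
  assumes "(T1, T, \<sigma>) \<in> diagrams n" "(T, T2, \<tau>) \<in> diagrams n"
  shows "(T1, T2, compose (leaves T1) \<tau> \<sigma>) \<in> diagrams n"
  using assms bij_betw_compose[of \<sigma> "leaves T1" "leaves T" \<tau> "leaves T2"]
  by (auto simp: diagrams_def)

text \<open>The bijections leave the tails \<open>w\<close> and \<open>x\<close> unchanged, so the
  conclusion of the first agreement is the premise of the second.\<close>

lemma compose_agree:
  assumes D: "(T1, T, \<sigma>) \<in> diagrams n" and D': "(S1, S, \<sigma>') \<in> diagrams n"
    and agr: "agree n (T1, T, \<sigma>) (S1, S, \<sigma>')" "agree n (T, T2, \<tau>) (S, S2, \<tau>')"
  shows "agree n (T1, T2, compose (leaves T1) \<tau> \<sigma>) (S1, S2, compose (leaves S1) \<tau>' \<sigma>')"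
proof (rule agreeI)
  fix l s w x assume *: "l \<in> leaves T1" "s \<in> leaves S1" "set w \<subseteq> {..<n}" "l @ w = s @ x"
  have "\<sigma> l @ w = \<sigma>' s @ x" using agreeD[OF agr(1) *] .
  moreover have "\<sigma> l \<in> leaves T" "\<sigma>' s \<in> leaves S"
    using D D' * by (auto simp: diagrams_def bij_betw_def)
  ultimately have "\<tau> (\<sigma> l) @ w = \<tau>' (\<sigma>' s) @ x" using agreeD[OF agr(2)] *(3) by blast
  then show "compose (leaves T1) \<tau> \<sigma> l @ w = compose (leaves S1) \<tau>' \<sigma>' s @ x"
    using * by (simp add: compose_def)
qed

text \<open>The product is a union over all composable representatives. By
  \<open>compose_agree\<close> they all contribute the same class, and the given pair shows that
  there is a contribution.\<close>

lemma G_group_mult: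
  assumes "n > 0" "(T1, T, \<sigma>) \<in> diagrams n" "(T, T2, \<tau>) \<in> diagrams n"
  shows "diagram_equiv n `` {(T1, T, \<sigma>)} \<otimes>\<^bsub>G_group n\<^esub> diagram_equiv n `` {(T, T2, \<tau>)} =
    diagram_equiv n `` {(T1, T2, compose (leaves T1) \<tau> \<sigma>)}"
proof -
  note eq = equiv_diagram_equiv[OF assms(1)]
  let ?S = "{diagram_equiv n `` {(S1, S2, compose (leaves S1) \<tau>' \<sigma>')} | S1 S S2 \<sigma>' \<tau>'.
    (S1, S, \<sigma>') \<in> diagram_equiv n `` {(T1, T, \<sigma>)} \<and> (S, S2, \<tau>') \<in> diagram_equiv n `` {(T, T2, \<tau>)}}"
  let ?C = "diagram_equiv n `` {(T1, T2, compose (leaves T1) \<tau> \<sigma>)}"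
  have "diagram_equiv n `` {(S1, S2, compose (leaves S1) \<tau>' \<sigma>')} = ?C"
    if "((T1, T, \<sigma>), (S1, S, \<sigma>')) \<in> diagram_equiv n" "((T, T2, \<tau>), (S, S2, \<tau>')) \<in> diagram_equiv n"
    for S1 S S2 \<sigma>' \<tau>'
  proof -
    have "((T1, T2, compose (leaves T1) \<tau> \<sigma>), (S1, S2, compose (leaves S1) \<tau>' \<sigma>')) \<in> diagram_equiv n"
      using that compose_in_diagrams compose_agree unfolding diagram_equiv_iff[OF assms(1)] by blast
    then show ?thesis using equiv_class_eq[OF eq] by metis
  qed
  moreover have "((T1, T, \<sigma>), (T1, T, \<sigma>)) \<in> diagram_equiv n" "((T, T2, \<tau>), (T, T2, \<tau>)) \<in> diagram_equiv n"
    using assms by (auto simp: diagram_equiv_def)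
  ultimately have "?S = {?C}" by blast
  then show ?thesis by (simp add: G_group_def)
qed

section \<open>The diagram of a pair of terms\<close>

lemma shape_in_trees: "u \<in> tms n \<Longrightarrow> shape u \<in> trees n"
  by (induction u) auto

text \<open>With only the label 0, two label lists are equal as soon as the trees have equally many
  leaves; surjectivity rests on this.\<close>

lemma shape_surj:
  "T \<in> trees n \<Longrightarrow> \<exists>u :: catalan_op trm. u \<in> tms n \<and> shape u = T \<and> set (labels u) \<subseteq> {0}"
proof (induction T)
  case Leaf
  then show ?case by (intro exI[of _ "Var 0"]) simp
next
  case (Node Ts)
  then have "\<forall>T\<in>set Ts. \<exists>u :: catalan_op trm. u \<in> tms n \<and> shape u = T \<and> set (labels u) \<subseteq> {0}"
    by auto
  then obtain f :: "tree \<Rightarrow> catalan_op trm" where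
    f: "\<And>T. T \<in> set Ts \<Longrightarrow> f T \<in> tms n" "\<And>T. T \<in> set Ts \<Longrightarrow> shape (f T) = T"
      "\<And>T. T \<in> set Ts \<Longrightarrow> set (labels (f T)) \<subseteq> {0}"
    by metis
  have "App Otimes (map f Ts) \<in> tms n" using f(1) Node.prems by auto
  moreover have "shape (App Otimes (map f Ts)) = Node Ts"
    using f(2) by (simp add: map_idI)
  moreover have "set (labels (App Otimes (map f Ts))) \<subseteq> {0}" using f(3) by auto
  ultimately show ?case by blast
qed

lemma shape_labels_length: "shape u = shape v \<Longrightarrow> length (labels u) = length (labels v)"
proof (induction u arbitrary: v)
  case (Var x)
  then show ?case by (cases v) auto
next
  case (App f ts)
  then obtain g us where v: "v = App g us" "map shape ts = map shape us" by (cases v) auto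
  have "length (concat (map labels ts)) = length (concat (map labels us))"
    using v(2) App.IH
  proof (induction ts arbitrary: us)
    case (Cons t ts)
    then obtain u us' where us: "us = u # us'" "shape t = shape u" "map shape ts = map shape us'"
      by (cases us) auto
    then show ?case using Cons.IH[of us'] Cons.prems(2)[of t u] Cons.prems(2) by auto
  qed simp
  then show ?case using v by simp
qed

text \<open>\<open>shape\<close> forgets function symbols, harmlessly since
  \<open>catalan_op\<close> has just one. Equal shapes have equally many leaves, so the concatenated
  label lists split at the same places.\<close>

lemma shape_labels_inject:
  fixes u v :: "catalan_op trm"
  shows "shape u = shape v \<Longrightarrow> labels u = labels v \<Longrightarrow> u = v"
proof (induction u arbitrary: v)
  case (Var x)
  then show ?case by (cases v) auto
next
  case (App f ts)
  then obtain g us where v: "v = App g us" "map shape ts = map shape us" by (cases v) auto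
  have "concat (map labels ts) = concat (map labels us)" using App.prems v by simp
  with v(2) App.IH have "ts = us"
  proof (induction ts arbitrary: us)
    case (Cons t ts)
    then obtain u us' where us: "us = u # us'" "shape t = shape u" "map shape ts = map shape us'"
      by (cases us) auto
    then have "labels t = labels u" "concat (map labels ts) = concat (map labels us')"
      using Cons.prems(3) shape_labels_length[of t u] by auto
    then show ?case using us Cons.IH[of us'] Cons.prems(2) by auto
  qed simp
  then show ?case using v by (cases f; cases g) simp
qed

lemma leaf_list_labels_inject:
  fixes u v :: "catalan_op trm"
  assumes "n > 0" "u \<in> tms n" "v \<in> tms n" "leaf_list u = leaf_list v" "labels u = labels v"
  shows "u = v"
proof -
  have "leaves (shape u) = leaves (shape v)" using assms(4) by (simp flip: set_leaf_list)
  then show ?thesis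
    using leaves_inject shape_in_trees shape_labels_inject assms by metis
qed

text \<open>The lookup matches leaves by position; for terms with equally many leaves this is the
  only order-preserving bijection.\<close>

definition diagram_of :: "'f trm \<Rightarrow> 'f trm \<Rightarrow> diagram" where
  "diagram_of u v = (shape u, shape v,
     restrict (\<lambda>l. the (map_of (zip (leaf_list u) (leaf_list v)) l)) (leaves (shape u)))"

lemma diagram_of_unique:
  assumes "\<sigma> \<in> extensional (leaves (shape u))" "map \<sigma> (leaf_list u) = leaf_list v"
  shows "diagram_of u v = (shape u, shape v, \<sigma>)"
proof -
  have "restrict (\<lambda>l. the (map_of (zip (leaf_list u) (leaf_list v)) l)) (leaves (shape u)) = \<sigma>"
  proof (rule extensionalityI[OF _ assms(1)])
    fix l assume l: "l \<in> leaves (shape u)"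
    then have "map_of (zip (leaf_list u) (map \<sigma> (leaf_list u))) l = Some (\<sigma> l)"
      by (simp add: map_of_zip_map set_leaf_list)
    then show "restrict (\<lambda>l. the (map_of (zip (leaf_list u) (leaf_list v)) l)) (leaves (shape u)) l = \<sigma> l"
      using l assms(2) by simp
  qed simp
  then show ?thesis by (simp add: diagram_of_def)
qed

lemma diagram_ofE:
  assumes "length (labels u) = length (labels v)"
  obtains \<sigma> where "diagram_of u v = (shape u, shape v, \<sigma>)" "\<sigma> \<in> extensional (leaves (shape u))"
    "map \<sigma> (leaf_list u) = leaf_list v"
proof -
  let ?\<sigma> = "restrict (\<lambda>l. the (map_of (zip (leaf_list u) (leaf_list v)) l)) (leaves (shape u))"
  have "map ?\<sigma> (leaf_list u) = leaf_list v"
  proof (rule nth_equalityI)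
    fix i assume "i < length (map ?\<sigma> (leaf_list u))"
    then show "map ?\<sigma> (leaf_list u) ! i = leaf_list v ! i"
      using map_of_zip_nth[of "leaf_list u" "leaf_list v" i] assms distinct_leaf_list[of u]
        nth_mem[of i "leaf_list u"] by (simp flip: set_leaf_list)
  qed (use assms in simp)
  then show thesis using that[of ?\<sigma>] by (simp add: diagram_of_def)
qed

text \<open>Both leaf lists are strictly sorted, so matching them by position is injective and
  monotone. The converse, \<open>diagram_of_order_preserving\<close>, holds because a strictly
  sorted list is determined by its set.\<close>

lemma order_preserving_leaf_map:
  assumes "u \<in> tms n" "v \<in> tms n" "map \<sigma> (leaf_list u) = leaf_list v"
    "\<sigma> \<in> extensional (leaves (shape u))"
  shows "(shape u, shape v, \<sigma>) \<in> diagrams n \<and> strict_mono_on (leaves (shape u)) \<sigma>"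
proof
  have "inj_on \<sigma> (set (leaf_list u))"
    using distinct_leaf_list[of v] by (simp add: distinct_map flip: assms(3))
  moreover have "\<sigma> ` set (leaf_list u) = set (leaf_list v)"
    by (simp flip: assms(3))
  ultimately show "(shape u, shape v, \<sigma>) \<in> diagrams n"
    using assms(4) shape_in_trees[OF assms(1)] shape_in_trees[OF assms(2)]
    by (auto simp: diagrams_def bij_betw_def set_leaf_list)
  have sorted: "sorted_wrt (\<lambda>x y. \<sigma> x < \<sigma> y) (leaf_list u)"
    using sorted_leaf_list[of v] by (simp add: sorted_wrt_map flip: assms(3))
  show "strict_mono_on (leaves (shape u)) \<sigma>"
  proof (rule strict_mono_onI)
    fix x y assume *: "x \<in> leaves (shape u)" "y \<in> leaves (shape u)" "x < y"
    then obtain i j where ij: "i < length (leaf_list u)" "leaf_list u ! i = x"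
      "j < length (leaf_list u)" "leaf_list u ! j = y"
      by (metis set_leaf_list in_set_conv_nth)
    have "i < j"
    proof (rule ccontr)
      assume "\<not> i < j"
      then consider "i = j" | "j < i" by linarith
      then show False
      proof cases
        case 2
        then have "y < x" using sorted_wrt_nth_less[OF sorted_leaf_list] ij by metis
        then show False using * by simp
      qed (use ij * in auto)
    qed
    then show "\<sigma> x < \<sigma> y" using sorted_wrt_nth_less[OF sorted] ij by metis
  qed
qed

lemma diagram_of_order_preserving:
  assumes "(shape u, shape v, \<sigma>) \<in> diagrams n" "strict_mono_on (leaves (shape u)) \<sigma>"
  shows "map \<sigma> (leaf_list u) = leaf_list v"
proof (rule strict_sorted_equal)
  have "sorted_wrt (\<lambda>x y. \<sigma> x < \<sigma> y) (leaf_list u)"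
    by (rule sorted_wrt_mono_rel[OF _ sorted_leaf_list])
      (use assms(2) in \<open>auto simp: set_leaf_list strict_mono_on_def\<close>)
  then show "sorted_wrt (<) (map \<sigma> (leaf_list u))" by (simp add: sorted_wrt_map)
  show "sorted_wrt (<) (leaf_list v)" by (rule sorted_leaf_list)
  show "set (map \<sigma> (leaf_list u)) = set (leaf_list v)"
    using assms(1) by (auto simp: set_leaf_list diagrams_def bij_betw_def)
qed

text \<open>Both bijections are restrictions of one action \<open>\<mu>\<close> that commutes with
  appending, so at a common word both sides equal \<open>\<mu>\<close> of that word. This makes the
  class of the diagram independent of the chosen pair.\<close>

lemma coherent_agree:
  assumes "coherent n r" "(u, v) \<in> r" "(u', v') \<in> r"
  shows "agree n (diagram_of u v) (diagram_of u' v')"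
proof -
  obtain \<mu> where \<mu>: "\<And>u v. (u, v) \<in> r \<Longrightarrow> leaf_list v = map \<mu> (leaf_list u)"
    "\<And>u v l w. (u, v) \<in> r \<Longrightarrow> l \<in> set (leaf_list u) \<Longrightarrow> \<mu> (l @ w) = \<mu> l @ w"
    using coherent_action[OF assms(1)] by blast
  have len: "length (labels u) = length (labels v)" "length (labels u') = length (labels v')"
    using coherent_labels[OF assms(1)] assms(2,3) by fastforce+
  obtain \<sigma> where \<sigma>: "diagram_of u v = (shape u, shape v, \<sigma>)" "map \<sigma> (leaf_list u) = leaf_list v"
    using diagram_ofE[OF len(1)] by metis
  obtain \<tau> where \<tau>: "diagram_of u' v' = (shape u', shape v', \<tau>)" "map \<tau> (leaf_list u') = leaf_list v'"
    using diagram_ofE[OF len(2)] by metis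
  have "map \<sigma> (leaf_list u) = map \<mu> (leaf_list u)" "map \<tau> (leaf_list u') = map \<mu> (leaf_list u')"
    using \<mu>(1) \<sigma>(2) \<tau>(2) assms by auto
  then have eq: "\<sigma> l = \<mu> l" "\<tau> s = \<mu> s" if "l \<in> leaves (shape u)" "s \<in> leaves (shape u')" for l s
    using that by (auto simp flip: set_leaf_list)
  show ?thesis
    unfolding \<sigma>(1) \<tau>(1)
  proof (rule agreeI)
    fix l s w x assume *: "l \<in> leaves (shape u)" "s \<in> leaves (shape u')" "l @ w = s @ x"
    have "\<sigma> l @ w = \<mu> (l @ w)"
      using eq(1)[OF *(1,2)] \<mu>(2)[OF assms(2)] *(1) by (simp add: set_leaf_list)
    moreover have "\<tau> s @ x = \<mu> (s @ x)"
      using eq(2)[OF *(1,2)] \<mu>(2)[OF assms(3)] *(2) by (simp add: set_leaf_list)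
    ultimately show "\<sigma> l @ w = \<tau> s @ x" using *(3) by simp
  qed
qed

text \<open>\<open>\<mu>\<close> fixes the leaves of \<open>p\<close>, hence all their extensions. A
  leaf \<open>l\<close> of \<open>u\<close> prolonged by some \<open>z\<close> is such an extension,
  and cancelling \<open>z\<close> shows that \<open>\<mu>\<close> fixes \<open>l\<close>. Equal
  leaves and equal labels give equal terms.\<close>

lemma coherent_partial_identity:
  assumes "n > 0" "coherent n r" "(p, q) \<in> r" "leaf_list p = leaf_list q" "(u, v) \<in> r"
  shows "u = v"
proof -
  obtain \<mu> where \<mu>: "\<And>u v. (u, v) \<in> r \<Longrightarrow> leaf_list v = map \<mu> (leaf_list u)"
    "\<And>u v l w. (u, v) \<in> r \<Longrightarrow> l \<in> set (leaf_list u) \<Longrightarrow> \<mu> (l @ w) = \<mu> l @ w"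
    using coherent_action[OF assms(2)] by blast
  have terms: "p \<in> tms n" "u \<in> tms n" "v \<in> tms n" using coherent_in_terms assms by blast+
  have fix_p: "\<mu> s = s" if "s \<in> set (leaf_list p)" for s
    using \<mu>(1)[OF assms(3)] assms(4) that by (metis map_eq_conv map_ident)
  have "\<mu> l = l" if l: "l \<in> set (leaf_list u)" for l
  proof -
    have "set l \<subseteq> {..<n}"
      using leaves_bounded[OF shape_in_trees[OF terms(2)]] l by (simp add: set_leaf_list)
    then obtain z w s where "s \<in> set (leaf_list p)" "l @ z = s @ w"
      using leaves_cover[OF assms(1) shape_in_trees[OF terms(1)]] by (metis set_leaf_list)
    then have "\<mu> l @ z = l @ z"
      using \<mu>(2)[OF assms(5) l] \<mu>(2)[OF assms(3)] fix_p by metis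
    then show ?thesis by simp
  qed
  then have "leaf_list v = leaf_list u"
    using \<mu>(1)[OF assms(5)] by (simp add: map_idI)
  then show ?thesis
    using leaf_list_labels_inject assms(1) terms coherent_labels[OF assms(2,5)] by metis
qed

section \<open>Generators of the structure monoid\<close>

text \<open>Turns the recursion along an address into iterated \<open>lift\<close>, so that facts
  about generators follow from the root case by induction on the address.\<close>

lemma rho_at_Cons:
  assumes "i < n"
  shows "rho_at (\<lambda>_. n) s t ((Otimes, i) # \<alpha>) = lift n i (rho_at (\<lambda>_. n) s t \<alpha>)"
    (is "?L = ?R")
proof (intro equalityI subrelI)
  fix u v assume "(u, v) \<in> ?L"
  then obtain p q where *: "u \<in> tms n" "sub u ((Otimes, i) # \<alpha>) = Some p" "(p, q) \<in> rho (\<lambda>_. n) s t"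
    "v = replace_at u ((Otimes, i) # \<alpha>) q"
    unfolding rho_at_def by blast
  obtain f ts where "u = App f ts" using *(2) by (cases u) auto
  then have u: "u = App Otimes ts" by (cases f) simp
  then have ts: "length ts = n" "set ts \<subseteq> tms n" using *(1) by auto
  then have "ts ! i \<in> tms n" using assms by auto
  moreover have "sub (ts ! i) \<alpha> = Some p" using *(2) u ts assms by simp
  ultimately have "(ts ! i, replace_at (ts ! i) \<alpha> q) \<in> rho_at (\<lambda>_. n) s t \<alpha>"
    unfolding rho_at_def using *(3) by blast
  then have "(App Otimes (take i ts @ ts ! i # drop (Suc i) ts),
      App Otimes (take i ts @ replace_at (ts ! i) \<alpha> q # drop (Suc i) ts)) \<in> ?R"
    by (rule liftI) (use ts assms set_take_subset[of i ts] set_drop_subset[of "Suc i" ts] in auto)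
  then show "(u, v) \<in> ?R"
    using u *(4) ts assms by (simp add: id_take_nth_drop[symmetric] upd_conv_take_nth_drop)
next
  fix u v assume "(u, v) \<in> ?R"
  then obtain as p' q' cs where *: "u = App Otimes (as @ p' # cs)" "v = App Otimes (as @ q' # cs)"
    "(p', q') \<in> rho_at (\<lambda>_. n) s t \<alpha>" "length as = i" "Suc (i + length cs) = n"
    "set (as @ cs) \<subseteq> tms n"
    unfolding lift_def by blast
  then obtain p q where **: "p' \<in> tms n" "sub p' \<alpha> = Some p" "(p, q) \<in> rho (\<lambda>_. n) s t"
    "q' = replace_at p' \<alpha> q"
    unfolding rho_at_def by blast
  have "u \<in> tms n" "sub u ((Otimes, i) # \<alpha>) = Some p" "v = replace_at u ((Otimes, i) # \<alpha>) q"
    using * ** by auto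
  then show "(u, v) \<in> ?L"
    unfolding rho_at_def using **(3) by blast
qed

lemma rho_at_Nil:
  assumes "rho ar s t \<subseteq> terms ar \<times> UNIV"
  shows "rho_at ar s t [] = rho ar s t"
  using assms unfolding rho_at_def by auto

lemma converse_rho: "(rho ar s t)\<inverse> = rho ar t s"
  unfolding rho_def by auto

lemma converse_lift: "(lift n i r)\<inverse> = lift n i (r\<inverse>)"
  unfolding lift_def by blast

section \<open>The Catalan equations as rotations\<close>

definition catalan_lhs :: "nat \<Rightarrow> nat \<Rightarrow> catalan_op trm" where
  "catalan_lhs n i = App Otimes (var_list 1 i @ [App Otimes (var_list (i + 1) (i + n))]
     @ var_list (i + n + 1) (2 * n - 1))"

definition catalan_rhs :: "nat \<Rightarrow> nat \<Rightarrow> catalan_op trm" where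
  "catalan_rhs n i = App Otimes (var_list 1 (i - 1) @ [App Otimes (var_list i (i + n - 1))]
     @ var_list (i + n) (2 * n - 1))"

lemma eqs_Catalan: "eqs (Catalan n) = {(catalan_lhs n i, catalan_rhs n i) | i. 0 < i \<and> i < n}"
  by (simp add: Catalan_def catalan_lhs_def catalan_rhs_def)

lemma arity_Catalan [simp]: "arity (Catalan n) = (\<lambda>_. n)"
  by (simp add: Catalan_def)

lemma subst_var_list: "map (subst \<phi>) (var_list i j) = map \<phi> [i..<Suc j]"
  by (simp add: var_list_def)

text \<open>Equation i = p + 1 has p arguments before \<open>a\<close>. The variables 1, ..., 2n-1
  are cut into the blocks \<open>as\<close> = 1..p, \<open>a\<close> = p+1, \<open>bs\<close> =
  p+2..p+n, \<open>b\<close> = p+n+1, \<open>cs\<close> = p+n+2..2n-1.\<close>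

lemma subst_catalan_sides:
  assumes "Suc p < n"
  shows "subst \<phi> (catalan_lhs n (Suc p)) =
      App Otimes (map \<phi> [1..<Suc p] @ \<phi> (Suc p) # App Otimes (map \<phi> [p + 2..<p + n + 1] @ [\<phi> (p + n + 1)])
        # map \<phi> [p + n + 2..<2 * n])"
    "subst \<phi> (catalan_rhs n (Suc p)) =
      App Otimes (map \<phi> [1..<Suc p] @ App Otimes (\<phi> (Suc p) # map \<phi> [p + 2..<p + n + 1]) # \<phi> (p + n + 1)
        # map \<phi> [p + n + 2..<2 * n])"
proof -
  have 1: "[1..<Suc (Suc p)] = [1..<Suc p] @ [Suc p]" by simp
  have 2: "[Suc p + 1..<Suc (Suc p + n)] = [p + 2..<p + n + 1] @ [p + n + 1]" using assms by simp
  have 3: "Suc (2 * n - 1) = 2 * n" "Suc p + n + 1 = p + n + 2" using assms by linarith+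
  have 4: "[Suc p..<Suc (Suc p + n - 1)] = Suc p # [p + 2..<p + n + 1]"
    by (subst upt_conv_Cons) (use assms in simp_all)
  have 5: "[Suc p + n..<2 * n] = (p + n + 1) # [p + n + 2..<2 * n]"
    by (subst upt_conv_Cons) (use assms in simp_all)
  show "subst \<phi> (catalan_lhs n (Suc p)) =
      App Otimes (map \<phi> [1..<Suc p] @ \<phi> (Suc p) # App Otimes (map \<phi> [p + 2..<p + n + 1] @ [\<phi> (p + n + 1)])
        # map \<phi> [p + n + 2..<2 * n])"
    unfolding catalan_lhs_def subst.simps map_append list.map subst_var_list 1 2 3 by simp
  show "subst \<phi> (catalan_rhs n (Suc p)) =
      App Otimes (map \<phi> [1..<Suc p] @ App Otimes (\<phi> (Suc p) # map \<phi> [p + 2..<p + n + 1]) # \<phi> (p + n + 1)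
        # map \<phi> [p + n + 2..<2 * n])"
    unfolding catalan_rhs_def subst.simps map_append list.map subst_var_list 3 4 5
    by simp
qed

text \<open>Each variable occurs once on either side, so a substitution can prescribe the five
  blocks of a rotation freely.\<close>

lemma rho_catalan:
  assumes "Suc p < n"
  shows "rho (\<lambda>_. n) (catalan_lhs n (Suc p)) (catalan_rhs n (Suc p)) = rotation n p"
proof (intro equalityI subrelI)
  fix u v assume "(u, v) \<in> rho (\<lambda>_. n) (catalan_lhs n (Suc p)) (catalan_rhs n (Suc p))"
  then obtain \<phi> where \<phi>: "\<phi> \<in> UNIV \<rightarrow> tms n" "u = subst \<phi> (catalan_lhs n (Suc p))"
    "v = subst \<phi> (catalan_rhs n (Suc p))"
    unfolding rho_def by blast
  show "(u, v) \<in> rotation n p"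
    unfolding \<phi>(2,3) subst_catalan_sides[OF assms]
    by (rule rotationI) (use \<phi>(1) assms in \<open>auto simp del: upt_Suc\<close>)
next
  fix u v assume "(u, v) \<in> rotation n p"
  then obtain as a bs b cs where *:
    "u = App Otimes (as @ a # App Otimes (bs @ [b]) # cs)"
    "v = App Otimes (as @ App Otimes (a # bs) # b # cs)"
    "set as \<subseteq> tms n" "a \<in> tms n" "set bs \<subseteq> tms n" "b \<in> tms n" "set cs \<subseteq> tms n"
    "length as = p" "Suc (length bs) = n" "Suc (Suc (p + length cs)) = n"
    by (rule rotationE)
  define xs where "xs = as @ a # bs @ b # cs"
  \<comment> \<open>The equations number their variables from 1, whence the shift; the value
    elsewhere only has to lie in \<open>tms n\<close>.\<close>
  define \<phi> where "\<phi> x = (if x - 1 < length xs then xs ! (x - 1) else Var 0)" for x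
  have len: "length xs = 2 * n - 1" using *(8-10) unfolding xs_def by simp
  have "set xs \<subseteq> tms n" using * by (simp add: xs_def)
  then have "\<phi> x \<in> tms n" for x
    unfolding \<phi>_def using nth_mem[of "x - 1" xs] by (auto simp del: nth_mem)
  then have \<phi>: "\<phi> \<in> UNIV \<rightarrow> tms n" by blast
  have "map \<phi> [1..<2 * n] = xs"
    by (rule nth_equalityI) (use len in \<open>auto simp: \<phi>_def\<close>)
  moreover have "[1..<2 * n] = [1..<Suc p] @ Suc p # [p + 2..<p + n + 1] @ (p + n + 1) # [p + n + 2..<2 * n]"
  proof -
    have "[1..<2 * n] = [1..<Suc p] @ [Suc p..<p + n + 1] @ [p + n + 1..<2 * n]"
      using assms upt_add_eq_append[of 1 "Suc p" "2 * n - Suc p"]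
        upt_add_eq_append[of "Suc p" "p + n + 1" "2 * n - (p + n + 1)"]
      by (simp del: upt_Suc add: mult_2)
    then show ?thesis
      using assms upt_conv_Cons[of "Suc p" "p + n + 1"] upt_conv_Cons[of "p + n + 1" "2 * n"]
      by (simp del: upt_Suc)
  qed
  ultimately have eq: "map \<phi> [1..<Suc p] @ \<phi> (Suc p) # map \<phi> [p + 2..<p + n + 1] @ \<phi> (p + n + 1)
      # map \<phi> [p + n + 2..<2 * n] = as @ a # bs @ b # cs"
    unfolding xs_def by simp
  have 1: "map \<phi> [1..<Suc p] = as" "\<phi> (Suc p) = a"
    "map \<phi> [p + 2..<p + n + 1] @ \<phi> (p + n + 1) # map \<phi> [p + n + 2..<2 * n] = bs @ b # cs"
    using eq *(8) by (simp_all del: upt_Suc)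
  have "length (map \<phi> [p + 2..<p + n + 1]) = length bs" using *(9) by (simp del: upt_Suc)
  from append_eq_append_conv[OF disjI1[OF this]] 1(3)
  have 2: "map \<phi> [p + 2..<p + n + 1] = bs" "\<phi> (p + n + 1) = b"
    "map \<phi> [p + n + 2..<2 * n] = cs"
    by blast+
  have "u = subst \<phi> (catalan_lhs n (Suc p))" "v = subst \<phi> (catalan_rhs n (Suc p))"
    unfolding subst_catalan_sides[OF assms] *(1,2) 1(1,2) 2 by simp_all
  then show "(u, v) \<in> rho (\<lambda>_. n) (catalan_lhs n (Suc p)) (catalan_rhs n (Suc p))"
    unfolding rho_def using \<phi> by blast
qed

lemma catalan_equation_cases:
  assumes "(s, t) \<in> eqs (Catalan n)"
  obtains p where "Suc p < n" "rho (\<lambda>_. n) s t = rotation n p" "rho (\<lambda>_. n) t s = (rotation n p)\<inverse>"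
proof -
  from assms obtain p where "Suc p < n" "s = catalan_lhs n (Suc p)" "t = catalan_rhs n (Suc p)"
    unfolding eqs_Catalan using gr0_implies_Suc by blast
  then show thesis using that[of p] rho_catalan[of p n] converse_rho by metis
qed

lemma addresses_Cons:
  "(g, i) # \<alpha> \<in> addresses (\<lambda>_. n) \<longleftrightarrow> i < n \<and> \<alpha> \<in> addresses (\<lambda>_. n)"
  by (auto simp: addresses_def)

text \<open>Both orientations of an equation are generators, so identifying the converse with the
  opposite generator makes the structure monoid closed under converses.\<close>

lemma coherent_and_converse_rho_at:
  assumes "(s, t) \<in> eqs (Catalan n) \<or> (t, s) \<in> eqs (Catalan n)" "\<alpha> \<in> addresses (\<lambda>_. n)"
  shows "coherent n (rho_at (\<lambda>_. n) s t \<alpha>) \<and> (rho_at (\<lambda>_. n) s t \<alpha>)\<inverse> = rho_at (\<lambda>_. n) t s \<alpha>"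
  using assms(2)
proof (induction \<alpha>)
  case Nil
  have "coherent n (rho (\<lambda>_. n) s t) \<and> coherent n (rho (\<lambda>_. n) t s)"
    using assms(1) coherent_rotation coherent_converse_rotation
    by (elim disjE catalan_equation_cases) auto
  then show ?case
    using rho_at_Nil[of "\<lambda>_. n" s t] rho_at_Nil[of "\<lambda>_. n" t s] coherent_in_terms converse_rho[of _ s t]
    by (metis mem_Sigma_iff UNIV_I subrelI)
next
  case (Cons x \<alpha>)
  obtain i where x: "x = (Otimes, i)" by (cases x) (metis catalan_op.exhaust)
  then have "i < n" "\<alpha> \<in> addresses (\<lambda>_. n)" using Cons.prems by (simp_all add: addresses_Cons)
  then show ?case
    using Cons.IH coherent_lift x by (simp add: rho_at_Cons converse_lift)
qed

lemma coherent_struct_maps: "r \<in> struct_maps (Catalan n) \<Longrightarrow> coherent n r"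
proof (induction rule: struct_maps.induct)
  case one
  then show ?case using coherent_Id_on by simp
next
  case (gen s t \<alpha>)
  then show ?case using coherent_and_converse_rho_at by simp
next
  case (comp r r')
  then show ?case using coherent_comp by blast
qed

lemma converse_struct_maps: "r \<in> struct_maps (Catalan n) \<Longrightarrow> r\<inverse> \<in> struct_maps (Catalan n)"
proof (induction rule: struct_maps.induct)
  case one
  then show ?case using struct_maps.one[of "Catalan n"] by simp
next
  case (gen s t \<alpha>)
  then have "rho_at (arity (Catalan n)) t s \<alpha> \<in> struct_maps (Catalan n)"
    by (intro struct_maps.gen) auto
  then show ?case using gen coherent_and_converse_rho_at by simp
next
  case (comp r r')
  then show ?case using struct_maps.comp by (simp add: converse_relcomp)
qed

section \<open>Connecting terms with equal variable lists\<close>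

definition reach :: "nat \<Rightarrow> catalan_op trm \<Rightarrow> catalan_op trm \<Rightarrow> bool" where
  "reach n u v \<longleftrightarrow> (\<exists>r\<in>struct_maps (Catalan n). (u, v) \<in> r)"

lemma reach_refl: "u \<in> tms n \<Longrightarrow> reach n u u"
  using struct_maps.one[of "Catalan n"] unfolding reach_def
  by (intro bexI[of _ "Id_on (tms n)"]) (simp_all add: Id_on_iff)

lemma reach_trans: "reach n u v \<Longrightarrow> reach n v w \<Longrightarrow> reach n u w"
  unfolding reach_def using struct_maps.comp by blast

lemma reach_sym: "reach n u v \<Longrightarrow> reach n v u"
  unfolding reach_def using converse_struct_maps by blast

lemma reach_labels: "reach n u v \<Longrightarrow> labels u = labels v"
  unfolding reach_def using coherent_struct_maps coherent_labels by blast

lemma reach_in_terms: "reach n u v \<Longrightarrow> u \<in> tms n \<and> v \<in> tms n"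
  unfolding reach_def using coherent_struct_maps coherent_in_terms by blast

lemma reach_rotation:
  assumes "Suc p < n" "(u, v) \<in> rotation n p"
  shows "reach n u v"
proof -
  let ?s = "catalan_lhs n (Suc p)" and ?t = "catalan_rhs n (Suc p)"
  have "(?s, ?t) \<in> eqs (Catalan n)" unfolding eqs_Catalan using assms(1) by blast
  then have "rho_at (\<lambda>_. n) ?s ?t [] \<in> struct_maps (Catalan n)"
    using struct_maps.gen[of ?s ?t "Catalan n" "[]"] by (simp add: addresses_def)
  moreover have "rotation n p \<subseteq> tms n \<times> UNIV"
    using coherent_in_terms(1)[OF coherent_rotation[OF assms(1)]] by auto
  then have "rho_at (\<lambda>_. n) ?s ?t [] = rotation n p"
    using rho_at_Nil[of "\<lambda>_. n" ?s ?t] rho_catalan[OF assms(1)] by simp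
  ultimately show ?thesis unfolding reach_def using assms(2) by auto
qed

text \<open>Lifting the unit does not give the unit, so the induction carries a single pair into the
  context: a generator at \<open>\<alpha>\<close> becomes one at a longer address, and a composite
  becomes a chain.\<close>

lemma reach_context:
  assumes "reach n p q" "set as \<subseteq> tms n" "set cs \<subseteq> tms n" "Suc (length as + length cs) = n"
  shows "reach n (App Otimes (as @ p # cs)) (App Otimes (as @ q # cs))"
proof -
  obtain r where "r \<in> struct_maps (Catalan n)" "(p, q) \<in> r"
    using assms(1) unfolding reach_def by blast
  then show ?thesis
  proof (induction arbitrary: p q rule: struct_maps.induct)
    case one
    then show ?case using assms by (auto intro!: reach_refl)
  next
    case (gen s t \<alpha>)
    let ?i = "length as"
    have i: "?i < n" using assms(4) by simp
    have "rho_at (arity (Catalan n)) s t ((Otimes, ?i) # \<alpha>) \<in> struct_maps (Catalan n)"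
      by (rule struct_maps.gen[OF gen(1)]) (use gen(2) i in \<open>simp add: addresses_Cons\<close>)
    moreover have "(App Otimes (as @ p # cs), App Otimes (as @ q # cs))
        \<in> rho_at (arity (Catalan n)) s t ((Otimes, ?i) # \<alpha>)"
      using gen(3) assms liftI[of p q "rho_at (\<lambda>_. n) s t \<alpha>" as ?i cs n]
      by (simp add: rho_at_Cons[OF i])
    ultimately show ?case unfolding reach_def by blast
  next
    case (comp r r')
    then show ?case using reach_trans by blast
  qed
qed

section \<open>Left combs as normal forms\<close>

fun left_comb :: "'f trm \<Rightarrow> bool" where
  "left_comb (Var x) \<longleftrightarrow> True"
| "left_comb (App f []) \<longleftrightarrow> True"
| "left_comb (App f (t # ts)) \<longleftrightarrow> left_comb t \<and> (\<forall>u\<in>set ts. \<exists>x. u = Var x)"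

lemma labels_nonempty: "n > 0 \<Longrightarrow> u \<in> tms n \<Longrightarrow> labels u \<noteq> []"
proof (induction u)
  case (App f ts)
  then have "ts ! 0 \<in> set ts" "ts ! 0 \<in> tms n" by auto
  then have "labels (ts ! 0) \<noteq> []" using App.IH App.prems(1) by blast
  then show ?case using \<open>ts ! 0 \<in> set ts\<close> by auto
qed simp

lemma labels_Vars:
  "\<forall>u\<in>set us. \<exists>x. u = Var x \<Longrightarrow> us = map Var (concat (map labels us))"
  by (induction us) auto

lemma length_labels_Vars:
  "\<forall>u\<in>set us. \<exists>x. u = Var x \<Longrightarrow> length (concat (map labels us)) = length us"
  by (metis labels_Vars length_map)

text \<open>A composite has at least two labels, so it cannot be confused with a variable. In a
  composite comb the last n-1 labels are the trailing variables, and the rest is the label list of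
  the first argument.\<close>

lemma left_comb_unique:
  fixes u v :: "catalan_op trm"
  assumes "n \<ge> 2"
  shows "u \<in> tms n \<Longrightarrow> v \<in> tms n \<Longrightarrow> left_comb u \<Longrightarrow> left_comb v \<Longrightarrow> labels u = labels v \<Longrightarrow> u = v"
proof (induction u arbitrary: v rule: left_comb.induct)
  have App_Cons: "\<exists>t us. ts = t # us \<and> Suc (length us) = n \<and> t \<in> tms n"
    if "App g ts \<in> tms n" for g :: catalan_op and ts
    using that assms by (cases ts) auto
  have not_single: "length (labels (App g ts)) \<ge> 2"
    if g: "App g ts \<in> tms n" "left_comb (App g ts)" for g :: catalan_op and ts
  proof -
    obtain t us where ts: "ts = t # us" "Suc (length us) = n" "t \<in> tms n"
      using App_Cons[OF g(1)] by blast
    have "length (concat (map labels us)) = length us"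
      by (rule length_labels_Vars) (use g ts in simp)
    moreover have "labels t \<noteq> []" using labels_nonempty[of n t] ts(3) assms by simp
    then have "length (labels t) \<ge> 1" by (simp add: Suc_leI)
    ultimately show ?thesis using ts(1,2) assms by simp
  qed
  {
    case (1 x)
    show ?case
    proof (cases v)
      case (App g ts)
      have "length (labels v) = 1" using arg_cong[OF 1(5), of length] by simp
      then show ?thesis using not_single[of g ts] 1(2,4) unfolding App by linarith
    qed (use 1 in simp)
  next
    case (2 f)
    then show ?case using App_Cons by blast
  next
    case (3 f t ts)
    show ?case
    proof (cases v)
      case (Var y)
      then have "length (labels (App f (t # ts))) = 1" using arg_cong[OF 3(6), of length] by simp
      then show ?thesis using not_single[OF 3(2,4)] by linarith
    next
      case (App g us')
      then obtain u us where v: "v = App g (u # us)" "Suc (length us) = n" "u \<in> tms n"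
        using App_Cons 3(3) by blast
      have vars: "\<forall>u\<in>set ts. \<exists>x. u = Var x" "\<forall>u\<in>set us. \<exists>x. u = Var x"
        using 3(4,5) v(1) by simp_all
      have "length ts = length us" using 3(2) v(2) by simp
      then have "length (concat (map labels ts)) = length (concat (map labels us))"
        using length_labels_Vars[OF vars(1)] length_labels_Vars[OF vars(2)] by simp
      then have eq: "labels t = labels u" "concat (map labels ts) = concat (map labels us)"
        using 3(6) v(1) by simp_all
      have "t \<in> tms n" "left_comb t" "left_comb u" using 3(2,4,5) v(1) by simp_all
      then have "t = u" using 3(1) v(3) eq(1) by blast
      moreover have "ts = us"
        using labels_Vars[OF vars(1)] labels_Vars[OF vars(2)] eq(2) by argo
      ultimately show ?thesis using v(1) by (cases f; cases g) simp
    qed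
  }
qed

text \<open>A rotation moves a bracket one place to the left and takes in the argument it passes as
  its new first entry. On arrival at the front that entry is the original first argument
  \<open>hd as\<close>.\<close>

lemma reach_front:
  assumes "as \<noteq> []" "App Otimes (as @ App Otimes bs # cs) \<in> tms n" "n > 0"
  shows "\<exists>ds es. Suc (length ds) = n \<and>
    reach n (App Otimes (as @ App Otimes bs # cs)) (App Otimes (App Otimes (hd as # ds) # es))"
  using assms
proof (induction as arbitrary: bs cs rule: rev_induct)
  case (snoc x as)
  have "length bs = n" using snoc.prems by simp
  then obtain bs' b where bs: "bs = bs' @ [b]" using snoc.prems(3) by (metis length_0_conv less_numeral_extra(3) rev_exhaust)
  have len: "Suc (length bs') = n" "Suc (Suc (length as + length cs)) = n"
    "set (as @ x # bs' @ b # cs) \<subseteq> tms n"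
    using snoc.prems bs by auto
  have 1: "reach n (App Otimes ((as @ [x]) @ App Otimes bs # cs)) (App Otimes (as @ App Otimes (x # bs') # b # cs))"
    using reach_rotation[of "length as" n] rotationI[OF len(3) HOL.refl len(1,2)] bs len(2) by simp
  show ?case
  proof (cases "as = []")
    case True
    then show ?thesis using 1 len(1) by auto
  next
    case False
    obtain ds es where "Suc (length ds) = n"
      "reach n (App Otimes (as @ App Otimes (x # bs') # b # cs)) (App Otimes (App Otimes (hd as # ds) # es))"
      using snoc.IH[OF False] reach_in_terms[OF 1] snoc.prems(3) by blast
    then show ?thesis using reach_trans[OF 1] False by (auto simp: hd_append)
  qed
qed simp

text \<open>Rotating a composite argument to the front keeps the number of leaves and enlarges the first
  argument, which is the inner induction.\<close>

lemma reach_left_comb: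
  assumes "n \<ge> 2" "u \<in> tms n"
  shows "\<exists>v. reach n u v \<and> left_comb v"
  using assms(2)
proof (induction "length (labels u)" arbitrary: u rule: less_induct)
  case (less u)
  have *: "\<exists>v. reach n (App Otimes (t # us)) v \<and> left_comb v"
    if "App Otimes (t # us) \<in> tms n" "length (labels (App Otimes (t # us))) = length (labels u)" for t us
    using that
  proof (induction "length (labels u) - length (labels t)" arbitrary: t us rule: less_induct)
    case inner: (less t us)
    have terms: "t \<in> tms n" "set us \<subseteq> tms n" "Suc (length us) = n" using inner.prems by auto
    have pos: "length (labels w) > 0" if "w \<in> tms n" for w :: "catalan_op trm"
      using labels_nonempty[of n w] that assms(1) by simp
    show ?case
    proof (cases "\<forall>w\<in>set us. \<exists>x. w = Var x")
      case True
      \<comment> \<open>As n is at least 2, a trailing variable contributes a label, so the outer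
        hypothesis applies to the first argument.\<close>
      have "length (labels t) < length (labels u)"
        using length_labels_Vars[OF True] inner.prems(2) terms(3) assms(1) by simp
      then obtain v where v: "reach n t v" "left_comb v" using less.hyps terms(1) by blast
      then have "reach n (App Otimes ([] @ t # us)) (App Otimes ([] @ v # us))"
        by (rule_tac reach_context) (use terms in auto)
      then show ?thesis using v(2) True by (intro exI[of _ "App Otimes (v # us)"]) simp
    next
      case False
      then obtain w where "w \<in> set us" "\<forall>x. w \<noteq> Var x" by blast
      then obtain xs bs cs where us: "us = xs @ App Otimes bs # cs"
        by (metis catalan_op.exhaust split_list trm.exhaust)
      have "\<exists>ds es. Suc (length ds) = n \<and> reach n (App Otimes ((t # xs) @ App Otimes bs # cs))
          (App Otimes (App Otimes (hd (t # xs) # ds) # es))"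
        by (rule reach_front) (use inner.prems(1) us assms(1) in auto)
      then obtain ds es where ds: "Suc (length ds) = n"
        and r: "reach n (App Otimes (t # us)) (App Otimes (App Otimes (t # ds) # es))"
        using us by auto
      have tm: "App Otimes (App Otimes (t # ds) # es) \<in> tms n" using reach_in_terms[OF r] by blast
      obtain d ds' where d: "ds = d # ds'" using ds assms(1) by (cases ds) auto
      then have "d \<in> tms n" using tm by simp
      \<comment> \<open>The new bracket contains \<open>d\<close> besides \<open>t\<close>, so the
        first argument has strictly gained labels and the inner measure drops.\<close>
      then have "length (labels t) < length (labels (App Otimes (t # ds)))" using pos[of d] d by simp
      moreover have len: "length (labels (App Otimes (App Otimes (t # ds) # es))) = length (labels u)"
        using reach_labels[OF r] inner.prems(2) by simp
      moreover have "length (labels (App Otimes (t # ds))) \<le> length (labels u)"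
        using len by simp
      ultimately have "length (labels u) - length (labels (App Otimes (t # ds)))
          < length (labels u) - length (labels t)" by linarith
      from inner.hyps[OF this tm len] show ?thesis using reach_trans[OF r] by blast
    qed
  qed
  show ?case
  proof (cases u)
    case (Var x)
    then show ?thesis using reach_refl[OF less.prems] by auto
  next
    case (App f ts)
    then obtain t us where "ts = t # us" using less.prems assms(1) by (cases ts) auto
    then show ?thesis using *[of t us] App less.prems by (cases f) simp
  qed
qed

lemma reach_if_labels_eq:
  assumes "n \<ge> 2" "u \<in> tms n" "v \<in> tms n" "labels u = labels v"
  shows "reach n u v"
proof -
  obtain u' v' where *: "reach n u u'" "left_comb u'" "reach n v v'" "left_comb v'"
    using reach_left_comb[OF assms(1,2)] reach_left_comb[OF assms(1,3)] by blast
  have "u' \<in> tms n" "v' \<in> tms n" using reach_in_terms *(1,3) by blast+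
  moreover have "labels u' = labels v'"
    using reach_labels[OF *(1)] reach_labels[OF *(3)] assms(4) by simp
  ultimately have "u' = v'"
    using left_comb_unique[OF assms(1)] *(2,4) by blast
  then show ?thesis using reach_trans[OF *(1)] reach_sym[OF *(3)] by simp
qed

section \<open>The isomorphism\<close>

lemma equiv_idem_cong:
  assumes "\<And>a b. a \<in> carrier M \<Longrightarrow> b \<in> carrier M \<Longrightarrow> a \<otimes>\<^bsub>M\<^esub> b \<in> carrier M" "\<one>\<^bsub>M\<^esub> \<in> carrier M"
  shows "equiv (carrier M) (idem_cong M)"
proof (rule equivI)
  have "a \<in> carrier M \<and> b \<in> carrier M" if "(a, b) \<in> idem_cong M" for a b
    using that by (induction rule: idem_cong.induct) (auto intro: assms)
  then show "idem_cong M \<subseteq> carrier M \<times> carrier M" by auto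
  show "refl_on (carrier M) (idem_cong M)" by (auto simp: refl_on_def intro: idem_cong.refl)
  show "sym (idem_cong M)" by (auto simp: sym_def intro: idem_cong.sym)
  show "trans (idem_cong M)" by (auto simp: trans_def intro: idem_cong.trans)
qed

text \<open>First isomorphism theorem: a surjective multiplicative map whose kernel congruence is
  exactly \<open>idem_cong M\<close> induces the isomorphism.\<close>

lemma universal_group_iso:
  assumes closed: "\<And>a b. a \<in> carrier M \<Longrightarrow> b \<in> carrier M \<Longrightarrow> a \<otimes>\<^bsub>M\<^esub> b \<in> carrier M" "\<one>\<^bsub>M\<^esub> \<in> carrier M"
    and surj: "h ` carrier M = carrier N"
    and hom: "\<And>a b. a \<in> carrier M \<Longrightarrow> b \<in> carrier M \<Longrightarrow> h (a \<otimes>\<^bsub>M\<^esub> b) = h a \<otimes>\<^bsub>N\<^esub> h b"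
    and ker: "\<And>a b. a \<in> carrier M \<Longrightarrow> b \<in> carrier M \<Longrightarrow> (a, b) \<in> idem_cong M \<longleftrightarrow> h a = h b"
  shows "universal_group M \<cong> N"
proof -
  note eq = equiv_idem_cong[OF closed]
  \<comment> \<open>\<open>h\<close> is constant on a congruence class, so the image of the class is
    a singleton.\<close>
  define k where "k A = the_elem (h ` A)" for A
  have k: "k (idem_cong M `` {a}) = h a" if a: "a \<in> carrier M" for a
  proof -
    have "h b = h a" if "b \<in> idem_cong M `` {a}" for b
    proof -
      have ab: "(a, b) \<in> idem_cong M" using that by simp
      then have "b \<in> carrier M" using equiv_type[OF eq] by blast
      then show ?thesis using ker[OF a] ab by simp
    qed
    moreover have "a \<in> idem_cong M `` {a}" using equiv_class_self[OF eq a] .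
    ultimately have "h ` (idem_cong M `` {a}) = {h a}" by blast
    then show ?thesis by (simp add: k_def)
  qed
  have car: "carrier (universal_group M) = (\<lambda>a. idem_cong M `` {a}) ` carrier M"
    by (auto simp: universal_group_def quotient_def)
  have mult: "idem_cong M `` {a} \<otimes>\<^bsub>universal_group M\<^esub> idem_cong M `` {b} = idem_cong M `` {a \<otimes>\<^bsub>M\<^esub> b}"
    if "a \<in> carrier M" "b \<in> carrier M" for a b
  proof -
    have 1: "idem_cong M `` {c \<otimes>\<^bsub>M\<^esub> d} = idem_cong M `` {a \<otimes>\<^bsub>M\<^esub> b}"
      if "c \<in> idem_cong M `` {a}" "d \<in> idem_cong M `` {b}" for c d
      using equiv_class_eq[OF eq idem_cong.mult[of a c M b d]] that by simp
    have 2: "a \<in> idem_cong M `` {a}" "b \<in> idem_cong M `` {b}"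
      using equiv_class_self[OF eq] that by auto
    have "(\<Union>c\<in>idem_cong M `` {a}. \<Union>d\<in>idem_cong M `` {b}. idem_cong M `` {c \<otimes>\<^bsub>M\<^esub> d})
        = (\<Union>c\<in>idem_cong M `` {a}. \<Union>d\<in>idem_cong M `` {b}. idem_cong M `` {a \<otimes>\<^bsub>M\<^esub> b})"
      by (intro SUP_cong HOL.refl 1)
    also have "\<dots> = idem_cong M `` {a \<otimes>\<^bsub>M\<^esub> b}"
      using 2 by blast
    finally have "(\<Union>c\<in>idem_cong M `` {a}. \<Union>d\<in>idem_cong M `` {b}. idem_cong M `` {c \<otimes>\<^bsub>M\<^esub> d})
        = idem_cong M `` {a \<otimes>\<^bsub>M\<^esub> b}" .
    then show ?thesis by (simp add: universal_group_def)
  qed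
  have "k \<in> iso (universal_group M) N"
    unfolding iso_def
  proof (intro CollectI conjI)
    show "k \<in> hom (universal_group M) N"
    proof (rule homI)
      fix A assume "A \<in> carrier (universal_group M)"
      then obtain a where a: "a \<in> carrier M" "A = idem_cong M `` {a}" unfolding car by blast
      then show "k A \<in> carrier N" using k[OF a(1)] surj by blast
      fix B assume "B \<in> carrier (universal_group M)"
      then obtain b where b: "b \<in> carrier M" "B = idem_cong M `` {b}" unfolding car by blast
      show "k (A \<otimes>\<^bsub>universal_group M\<^esub> B) = k A \<otimes>\<^bsub>N\<^esub> k B"
        unfolding a(2) b(2) mult[OF a(1) b(1)] k[OF a(1)] k[OF b(1)] k[OF closed(1)[OF a(1) b(1)]]
        by (rule hom[OF a(1) b(1)])
    qed
    show "bij_betw k (carrier (universal_group M)) (carrier N)"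
      unfolding bij_betw_def
    proof
      show "inj_on k (carrier (universal_group M))"
      proof (rule inj_onI)
        fix A B assume "A \<in> carrier (universal_group M)" "B \<in> carrier (universal_group M)" "k A = k B"
        then obtain a b where ab: "a \<in> carrier M" "A = idem_cong M `` {a}"
          "b \<in> carrier M" "B = idem_cong M `` {b}" unfolding car by blast
        then have "(a, b) \<in> idem_cong M" using ker k \<open>k A = k B\<close> by simp
        then show "A = B" using equiv_class_eq[OF eq] ab by simp
      qed
      show "k ` carrier (universal_group M) = carrier N"
        unfolding car surj[symmetric] using k by (simp add: image_image)
    qed
  qed
  then show ?thesis unfolding is_iso_def by blast
qed

lemma diagram_of_in_diagrams:
  assumes "coherent n r" "(u, v) \<in> r"
  shows "diagram_of u v \<in> diagrams n"
proof -
  obtain \<sigma> where "diagram_of u v = (shape u, shape v, \<sigma>)" "\<sigma> \<in> extensional (leaves (shape u))"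
    "map \<sigma> (leaf_list u) = leaf_list v"
    using diagram_ofE[of u v] coherent_labels[OF assms] by metis
  then show ?thesis
    using order_preserving_leaf_map[OF coherent_in_terms[OF assms], of \<sigma>] by simp
qed

text \<open>The pair is chosen arbitrarily; \<open>symbol_eq\<close> shows that the choice is
  irrelevant for coherent \<open>r\<close>.\<close>

definition symbol :: "nat \<Rightarrow> (catalan_op trm \<times> catalan_op trm) set \<Rightarrow> diagram set" where
  "symbol n r = diagram_equiv n `` {case SOME x. x \<in> r of (u, v) \<Rightarrow> diagram_of u v}"

lemma coherent_diagram_equiv:
  assumes "n > 0" "coherent n r" "(u, v) \<in> r" "(u', v') \<in> r"
  shows "(diagram_of u v, diagram_of u' v') \<in> diagram_equiv n"
  using coherent_agree[OF assms(2-4)] diagram_of_in_diagrams[OF assms(2)] assms(3,4)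
    diagram_equiv_iff[OF assms(1)] by (metis prod_cases3)

lemma symbol_eq:
  assumes "n > 0" "coherent n r" "(u, v) \<in> r"
  shows "symbol n r = diagram_equiv n `` {diagram_of u v}"
proof -
  obtain u' v' where x: "(SOME x. x \<in> r) = (u', v')" by (cases "SOME x. x \<in> r")
  then have "(u', v') \<in> r" using assms(3) by (metis someI)
  then show ?thesis
    unfolding symbol_def x prod.case
    by (intro equiv_class_eq[OF equiv_diagram_equiv[OF assms(1)]] coherent_diagram_equiv[OF assms(1,2)] assms(3))
qed

text \<open>A pair of the composite passes through a term \<open>v\<close>, whose shape serves as
  the common middle tree; the representatives compose directly.\<close>

lemma symbol_mult:
  assumes "n > 0" "coherent n r" "coherent n r'"
  shows "symbol n (r O r') = symbol n r \<otimes>\<^bsub>F_group n\<^esub> symbol n r'"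
proof -
  have c: "coherent n (r O r')" using coherent_comp assms by blast
  then obtain u v w where uvw: "(u, v) \<in> r" "(v, w) \<in> r'" "(u, w) \<in> r O r'"
    unfolding coherent_def by fast
  obtain \<sigma> where \<sigma>: "diagram_of u v = (shape u, shape v, \<sigma>)" "map \<sigma> (leaf_list u) = leaf_list v"
    using diagram_ofE[of u v] coherent_labels[OF assms(2) uvw(1)] by metis
  obtain \<tau> where \<tau>: "diagram_of v w = (shape v, shape w, \<tau>)" "map \<tau> (leaf_list v) = leaf_list w"
    using diagram_ofE[of v w] coherent_labels[OF assms(3) uvw(2)] by metis
  have "map (compose (leaves (shape u)) \<tau> \<sigma>) (leaf_list u) = map \<tau> (map \<sigma> (leaf_list u))"
    by (simp add: compose_def set_leaf_list)
  then have "diagram_of u w = (shape u, shape w, compose (leaves (shape u)) \<tau> \<sigma>)"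
    using diagram_of_unique[of "compose (leaves (shape u)) \<tau> \<sigma>" u w] \<sigma> \<tau> by simp
  then show ?thesis
    using symbol_eq[OF assms(1) c uvw(3)] symbol_eq[OF assms(1,2) uvw(1)]
      symbol_eq[OF assms(1,3) uvw(2)] G_group_mult[OF assms(1), of "shape u" "shape v" \<sigma> "shape w" \<tau>]
      diagram_of_in_diagrams[OF assms(2) uvw(1)] diagram_of_in_diagrams[OF assms(3) uvw(2)] \<sigma> \<tau>
    by (simp add: F_group_def)
qed

lemma symbol_in_F_group:
  assumes "n > 0" "coherent n r"
  shows "symbol n r \<in> carrier (F_group n)"
proof -
  obtain u v where uv: "(u, v) \<in> r" using assms(2) unfolding coherent_def by fast
  note d = diagram_of_in_diagrams[OF assms(2) uv]
  obtain \<sigma> where \<sigma>: "diagram_of u v = (shape u, shape v, \<sigma>)" "\<sigma> \<in> extensional (leaves (shape u))"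
    "map \<sigma> (leaf_list u) = leaf_list v"
    using diagram_ofE[of u v] coherent_labels[OF assms(2) uv] by metis
  then have "strict_mono_on (leaves (shape u)) \<sigma>"
    using order_preserving_leaf_map coherent_in_terms[OF assms(2) uv] by metis
  moreover have "diagram_of u v \<in> symbol n r" "symbol n r \<in> diagrams n // diagram_equiv n"
    using symbol_eq[OF assms uv] equiv_class_self[OF equiv_diagram_equiv[OF assms(1)] d] d
    by (auto intro: quotientI)
  ultimately show ?thesis using \<sigma>(1) unfolding F_group_def G_group_def by auto
qed

lemma symbol_surj:
  assumes "n \<ge> 2" "X \<in> carrier (F_group n)"
  shows "\<exists>r\<in>struct_maps (Catalan n). symbol n r = X"
proof -
  have n: "n > 0" using assms(1) by simp
  obtain T1 T2 \<sigma> where X: "X \<in> diagrams n // diagram_equiv n" "(T1, T2, \<sigma>) \<in> X"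
    "strict_mono_on (leaves T1) \<sigma>"
    using assms(2) unfolding F_group_def G_group_def by auto
  then have D: "(T1, T2, \<sigma>) \<in> diagrams n"
    using in_quotient_imp_subset[OF equiv_diagram_equiv[OF n]] by blast
  then have "T1 \<in> trees n" "T2 \<in> trees n" by (simp_all add: diagrams_def)
  then obtain u v :: "catalan_op trm" where
    uv: "u \<in> tms n" "v \<in> tms n" and sh: "shape u = T1" "shape v = T2"
    and lab: "set (labels u) \<subseteq> {0}" "set (labels v) \<subseteq> {0}"
    using shape_surj[of T1 n] shape_surj[of T2 n] by blast
  have m: "map \<sigma> (leaf_list u) = leaf_list v"
    using diagram_of_order_preserving[of u v \<sigma> n] D X(3) sh by simp
  then have d: "diagram_of u v = (T1, T2, \<sigma>)"
    using diagram_of_unique[of \<sigma> u v] D sh by (simp add: diagrams_def)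
  \<comment> \<open>Lists of zeros of equal length coincide, which is what connecting
    \<open>u\<close> and \<open>v\<close> requires.\<close>
  have "length (labels u) = length (labels v)" using m by (metis length_leaf_list length_map)
  moreover have "labels w = replicate (length (labels w)) 0" if "set (labels w) \<subseteq> {0}"
    for w :: "catalan_op trm"
    using that by (intro replicate_eqI) auto
  ultimately have "labels u = labels v" using lab by metis
  then obtain r where r: "r \<in> struct_maps (Catalan n)" "(u, v) \<in> r"
    using reach_if_labels_eq[OF assms(1) uv] unfolding reach_def by blast
  have "symbol n r = diagram_equiv n `` {(T1, T2, \<sigma>)}"
    using symbol_eq[OF n coherent_struct_maps[OF r(1)] r(2)] d by simp
  also have "\<dots> = X"
    using X(1)
  proof (rule quotientE)
    fix D assume "D \<in> diagrams n" "X = diagram_equiv n `` {D}"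
    then show "diagram_equiv n `` {(T1, T2, \<sigma>)} = X"
      using X(2) equiv_class_eq[OF equiv_diagram_equiv[OF n]] by auto
  qed
  finally show ?thesis using r(1) by blast
qed

lemma symbol_eq_of_common:
  assumes "n > 0" "coherent n r" "coherent n r'" "(u, v) \<in> r" "(u, v) \<in> r'"
  shows "symbol n r = symbol n r'"
  using symbol_eq assms by metis

text \<open>From a chain \<open>u\<close>, \<open>v\<close>, \<open>w\<close> in
  \<open>e O e = e\<close> also \<open>(u, w)\<close> lies in \<open>e\<close>. The action sends the
  leaves of \<open>u\<close> both to those of \<open>v\<close> and to those of \<open>w\<close>, so
  \<open>v = w\<close> and \<open>e\<close> shares the pair \<open>(v, v)\<close> with the
  unit.\<close>

lemma symbol_idem:
  assumes "n > 0" "coherent n e" "e O e = e"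
  shows "symbol n e = symbol n (Id_on (tms n))"
proof -
  have "\<exists>x. x \<in> e O e" using assms unfolding coherent_def by auto
  then obtain u v w where uvw: "(u, v) \<in> e" "(v, w) \<in> e" "(u, w) \<in> e"
    using assms(3) by fastforce
  obtain \<mu> where \<mu>: "\<And>u v. (u, v) \<in> e \<Longrightarrow> leaf_list v = map \<mu> (leaf_list u)"
    using coherent_action[OF assms(2)] by metis
  have vw: "leaf_list v = leaf_list w" using \<mu> uvw by metis
  then have "v = w"
    using coherent_partial_identity[OF assms(1,2) uvw(2) vw uvw(2)] by blast
  moreover have "v \<in> tms n" using coherent_in_terms[OF assms(2)] uvw by blast
  ultimately show ?thesis
    using symbol_eq_of_common[OF assms(1,2) coherent_Id_on, of v v] uvw by auto
qed

text \<open>Plugging gives both maps the same source term. The two diagrams then share their first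
  tree, so equivalence forces equal bijections and hence equal targets.\<close>

lemma symbol_eq_imp_common:
  assumes "n > 0" "coherent n r" "coherent n r'" "symbol n r = symbol n r'"
  shows "\<exists>p q. (p, q) \<in> r \<and> (p, q) \<in> r'"
proof -
  obtain u v where uv: "(u, v) \<in> r" using assms(2) unfolding coherent_def by fast
  obtain u' v' where uv': "(u', v') \<in> r'" using assms(3) unfolding coherent_def by fast
  obtain f g where "f \<in> UNIV \<rightarrow> tms n" "g \<in> UNIV \<rightarrow> tms n" and p: "plug f 0 u = plug g 0 u'"
    using plug_unify coherent_in_terms(1) assms(2,3) uv uv' by metis
  then have pq: "(plug f 0 u, plug f 0 v) \<in> r" "(plug f 0 u, plug g 0 v') \<in> r'"
    using coherent_plug[OF assms(2) uv] coherent_plug[OF assms(3) uv'] by metis+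
  let ?p = "plug f 0 u" and ?q = "plug f 0 v" and ?q' = "plug g 0 v'"
  have "diagram_equiv n `` {diagram_of ?p ?q} = diagram_equiv n `` {diagram_of ?p ?q'}"
    using symbol_eq[OF assms(1,2) pq(1)] symbol_eq[OF assms(1,3) pq(2)] assms(4) by simp
  then have eq: "(diagram_of ?p ?q, diagram_of ?p ?q') \<in> diagram_equiv n"
    using eq_equiv_class_iff[OF equiv_diagram_equiv[OF assms(1)]]
      diagram_of_in_diagrams[OF assms(2) pq(1)] diagram_of_in_diagrams[OF assms(3) pq(2)] by blast
  have lab: "labels ?p = labels ?q" "labels ?p = labels ?q'"
    using coherent_labels assms pq by blast+
  obtain \<sigma> where \<sigma>: "diagram_of ?p ?q = (shape ?p, shape ?q, \<sigma>)" "map \<sigma> (leaf_list ?p) = leaf_list ?q"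
    using diagram_ofE[of ?p ?q] lab by metis
  obtain \<tau> where \<tau>: "diagram_of ?p ?q' = (shape ?p, shape ?q', \<tau>)" "map \<tau> (leaf_list ?p) = leaf_list ?q'"
    using diagram_ofE[of ?p ?q'] lab by metis
  have agr: "agree n (shape ?p, shape ?q, \<sigma>) (shape ?p, shape ?q', \<tau>)"
    using eq diagram_equiv_iff[OF assms(1)] \<sigma>(1) \<tau>(1) by simp
  have "\<sigma> l = \<tau> l" if "l \<in> set (leaf_list ?p)" for l
    using agreeD[OF agr, of l l "[]" "[]"] that by (simp add: set_leaf_list)
  then have "leaf_list ?q = leaf_list ?q'" using \<sigma>(2) \<tau>(2) by (metis map_cong)
  then have "?q = ?q'"
    using leaf_list_labels_inject[OF assms(1)] lab coherent_in_terms(2) assms(2,3) pq by metis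
  then show ?thesis using pq by metis
qed

text \<open>One direction is an induction over the congruence, with coherence carried along for the
  product case; the other compares \<open>r\<close> and \<open>r'\<close> through the product of
  \<open>r\<close>, the converse of \<open>r'\<close>, and \<open>r'\<close>.\<close>

lemma idem_cong_iff_symbol:
  assumes "n > 0" "r \<in> struct_maps (Catalan n)" "r' \<in> struct_maps (Catalan n)"
  shows "(r, r') \<in> idem_cong (Struct (Catalan n)) \<longleftrightarrow> symbol n r = symbol n r'"
proof
  let ?M = "Struct (Catalan n)"
  have M: "carrier ?M = struct_maps (Catalan n)" "\<And>a b. a \<otimes>\<^bsub>?M\<^esub> b = a O b"
    "\<one>\<^bsub>?M\<^esub> = Id_on (tms n)" by (simp_all add: Struct_def)
  {
    fix a b assume "(a, b) \<in> idem_cong ?M"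
    then have "coherent n a \<and> coherent n b \<and> symbol n a = symbol n b"
    proof (induction rule: idem_cong.induct)
      case (idem e)
      then show ?case
        using symbol_idem[OF assms(1)] coherent_struct_maps coherent_Id_on by (simp add: M)
    next
      case (mult a b c d)
      then show ?case using symbol_mult[OF assms(1)] coherent_comp by (simp add: M)
    qed (auto simp: M coherent_struct_maps)
  }
  then show "(r, r') \<in> idem_cong ?M \<Longrightarrow> symbol n r = symbol n r'" by blast
  assume "symbol n r = symbol n r'"
  then obtain p q where pq: "(p, q) \<in> r" "(p, q) \<in> r'"
    using symbol_eq_imp_common[OF assms(1)] coherent_struct_maps assms(2,3) by blast
  \<comment> \<open>A fixed point makes \<open>e\<close> a partial identity, and partial identities
    are idempotent.\<close>
  have sub_id: "(e, Id_on (tms n)) \<in> idem_cong ?M"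
    if "e \<in> struct_maps (Catalan n)" "(x, x) \<in> e" for e x
  proof -
    have "e \<subseteq> Id"
      using coherent_partial_identity[OF assms(1) coherent_struct_maps[OF that(1)] that(2) HOL.refl] by auto
    then have "e O e = e" by fast
    then show ?thesis using idem_cong.idem[of e ?M] that(1) by (simp add: M)
  qed
  have c: "r'\<inverse> \<in> struct_maps (Catalan n)" using converse_struct_maps assms(3) by blast
  have 1: "(r O r'\<inverse>, Id_on (tms n)) \<in> idem_cong ?M" "(r'\<inverse> O r', Id_on (tms n)) \<in> idem_cong ?M"
    using sub_id[OF struct_maps.comp[OF assms(2) c], of p]
      sub_id[OF struct_maps.comp[OF c assms(3)], of q] pq by blast+
  have refl: "(r, r) \<in> idem_cong ?M" "(r', r') \<in> idem_cong ?M"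
    using idem_cong.refl[of r ?M] idem_cong.refl[of r' ?M] assms(2,3) by (simp_all add: M)
  have id1: "r O Id_on (tms n) = r"
    using coherent_in_terms(2)[OF coherent_struct_maps[OF assms(2)]]
    by (auto simp: relcomp_unfold Id_on_iff)
  have id2: "Id_on (tms n) O r' = r'"
    using coherent_in_terms(1)[OF coherent_struct_maps[OF assms(3)]]
    by (auto simp: relcomp_unfold Id_on_iff)
  \<comment> \<open>The same triple product, bracketed in two ways, is congruent to \<open>r\<close>
    and to \<open>r'\<close>.\<close>
  have "(r O (r'\<inverse> O r'), r) \<in> idem_cong ?M" "((r O r'\<inverse>) O r', r') \<in> idem_cong ?M"
    using idem_cong.mult[OF refl(1) 1(2)] idem_cong.mult[OF 1(1) refl(2)] by (simp_all add: M id1 id2)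
  then show "(r, r') \<in> idem_cong ?M"
    unfolding O_assoc by (rule idem_cong.trans[OF idem_cong.sym])
qed

theorem theorem5p2p11:
  fixes n :: nat
  assumes "n \<ge> 2"
  shows "StructG (Catalan n) \<cong> F_group n"
  unfolding StructG_def
proof (rule universal_group_iso[where h = "symbol n"])
  have n: "n > 0" using assms by simp
  let ?M = "Struct (Catalan n)"
  have M: "carrier ?M = struct_maps (Catalan n)" "\<And>a b. a \<otimes>\<^bsub>?M\<^esub> b = a O b"
    "\<one>\<^bsub>?M\<^esub> = Id_on (tms n)" by (simp_all add: Struct_def)
  show "symbol n ` carrier ?M = carrier (F_group n)"
    using symbol_in_F_group[OF n coherent_struct_maps] symbol_surj[OF assms] by (force simp: M)
  show "\<one>\<^bsub>?M\<^esub> \<in> carrier ?M"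
    using struct_maps.one[of "Catalan n"] by (simp add: M)
  fix a b assume "a \<in> carrier ?M" "b \<in> carrier ?M"
  then have ab: "a \<in> struct_maps (Catalan n)" "b \<in> struct_maps (Catalan n)" by (simp_all add: M)
  show "a \<otimes>\<^bsub>?M\<^esub> b \<in> carrier ?M"
    using struct_maps.comp[OF ab] by (simp add: M)
  show "symbol n (a \<otimes>\<^bsub>?M\<^esub> b) = symbol n a \<otimes>\<^bsub>F_group n\<^esub> symbol n b"
    using symbol_mult[OF n] coherent_struct_maps ab by (simp add: M)
  show "(a, b) \<in> idem_cong ?M \<longleftrightarrow> symbol n a = symbol n b"
    using idem_cong_iff_symbol[OF n ab] .
qed

end
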